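(* Let $\mathbb{F}=\mathbb{R}$ or $\mathbb{C}$, let $n,m\in\mathbb{N}_+$ with $m\leq n$, and let $\Lambda=\mathrm{diag}(\lambda_1,\dots,\lambda_n)\in\mathbb{F}^{n\times n}$ with $|\lambda_1|>\dots>|\lambda_n|>0$. Let $V\in\mathbb{F}^{n\times n}$ satisfy $VV^*=V^*V=I_n$ and put $A:=V\Lambda V^*$. Let $Y\in\mathbb{F}^{n\times m}$ and put $X:=V^*Y$. Assume $\det(X(1:j,1:j))\neq 0$ for every $j\in[m]$. Then there exist a unique unit lower triangular $L\in\mathbb{F}^{n\times m}$ and a unique upper triangular $U\in\mathbb{F}^{m\times m}$ such that $X=LU$. Suppose further that all strictly lower triangular entries of $L$ and of $L(1:m,:)^{-1}$ are nonzero. For each $k\in\mathbb{N}_+$ let $\tilde{Q}_k\tilde{R}_k=A^kY$ be a QR factorization of $A^kY$. Then for every $j\in[m]$, as $k\to\infty$, \[ |V(:,i)^*\tilde{Q}_k(:,j)|=\begin{cases} |(L(1:m,:)^{-1})(j,i)|\,\dfrac{|\lambda_j|^k}{|\lambda_i|^k}(1+o(1)),& i\in[j-1],\\[2mm] 1+o(1),& i=j,\\[1mm] |L(i,j)|\,\dfrac{|\lambda_i|^k}{|\lambda_j|^k}(1+o(1)),& i\in[n]\setminus[j]. \end{cases} \] In particular, for $i\in[n]$, $j\in[m]$ with $i\neq j$, \[ |V(:,i)^*\tilde{Q}_k(:,j)|=\Theta\left(\frac{|\lambda_{\max\{i,j\}}|^k}{|\lambda_{\min\{i,j\}}|^k}\right),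 \] and for $j\in[m]$, \[ 1-|V(:,j)^*\tilde{Q}_k(:,j)|=\Theta\left(\max\left\{\frac{|\lambda_j|}{|\lambda_{j-1}|},\frac{|\lambda_{j+1}|}{|\lambda_j|}\right\}^{2k}\right), \] where the ratio $|\lambda_j|/|\lambda_{j-1}|$ is read as $0$ when $j=1$ and the ratio $|\lambda_{j+1}|/|\lambda_j|$ is read as $0$ when $j=n$.
   Context: Notation: $[r]=\{1,\dots,r\}$ (with $[0]=\emptyset$). $M(i,j)$ is the $(i,j)$ entry of a matrix $M$; $M(:,j)$ its $j$-th column; $M(a:b,c:d)$ the submatrix with rows $a,\dots,b$ and columns $c,\dots,d$; $M(a:b,:)$ keeps all columns. $M^*$ is the conjugate transpose (transpose if $\mathbb{F}=\mathbb{R}$). An $n\times m$ matrix $L$ with $n\ge m$ is unit lower triangular if $L(j,j)=1$ for $j\in[m]$ and $L(i,j)=0$ for $i<j$; its strictly lower triangular entries are those with $i>j$. A QR factorization of an $n\times m$ matrix $M$ of full column rank is $M=QR$ with $Q\in\mathbb{F}^{n\times m}$ having orthonormal columns and $R\in\mathbb{F}^{m\times m}$ upper triangular. $o(1)$ denotes a quantity tending to $0$ as $k\to\infty$ with all other data fixed; $f(k)=\Theta(g(k))$, for nonnegative $f,g$, means there are constants $c_1,c_2>0$ (independent of $k$) with $c_1g(k)\le f(k)\le c_2g(k)$ for all sufficiently large $k$. *)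

theory Defs
  imports
    Complex_Main
    "HOL-Library.Landau_Symbols"
    "Jordan_Normal_Form.Schur_Decomposition"
    "Jordan_Normal_Form.Gauss_Jordan_Elimination"
    "Jordan_Normal_Form.DL_Submatrix"
begin

text \<open>
  The scalar field \<open>\<real>\<close> or \<open>\<complex>\<close>. Both are instances of the following class, and the lemma
  \<open>real_or_complex_field_cases\<close> shows that there are no others up to isomorphism (the axiom
  \<open>mult_conjugate\<close> then also determines the norm).
\<close>

class real_or_complex_field = real_normed_field + conjugatable_field +
  assumes mult_conjugate_scaleR: "x * conjugate x = (norm x)\<^sup>2 *\<^sub>R 1"

instance real :: real_or_complex_field
  by intro_classes (simp add: power2_eq_square)

instance complex :: real_or_complex_field
  by intro_classes (simp add: complex_norm_square[symmetric] scaleR_conv_of_real)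

lemma mult_conjugate:
  fixes x :: "'a :: real_or_complex_field"
  shows "x * conjugate x = of_real ((norm x)\<^sup>2)"
  unfolding of_real_def by (rule mult_conjugate_scaleR)

lemma real_or_complex_field_cases:
  fixes ty :: "'a :: real_or_complex_field itself"
  obtains
    (real) "\<And>x :: 'a. \<exists>a. x = of_real a" "\<And>x :: 'a. conjugate x = x"
  | (complex) j where "j * j = (-1 :: 'a)" "conjugate j = - j"
      "\<And>x. \<exists>a b. x = of_real a + of_real b * j" "\<And>a. conjugate (of_real a :: 'a) = of_real a"
proof -
  have one: "conjugate 1 = (1 :: 'a)"
    using mult_conjugate[of "1 :: 'a"] by simp
  have trace: "\<exists>t. x + conjugate x = of_real t" for x :: 'a
  proof -
    have "(1 + x) * conjugate (1 + x) = 1 + (x + conjugate x) + x * conjugate x"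
      by (simp add: conjugate_dist_add one algebra_simps)
    then have "x + conjugate x = of_real ((norm (1 + x))\<^sup>2) - 1 - of_real ((norm x)\<^sup>2)"
      unfolding mult_conjugate by (simp add: algebra_simps)
    then have "x + conjugate x = of_real ((norm (1 + x))\<^sup>2 - 1 - (norm x)\<^sup>2)" by simp
    then show ?thesis by blast
  qed
  have conj_real: "conjugate (of_real a) = (of_real a :: 'a)" for a
  proof (cases "a = 0")
    case False
    have "of_real a * conjugate (of_real a) = (of_real a * of_real a :: 'a)"
      using mult_conjugate[of "of_real a :: 'a"] by (simp add: power2_eq_square flip: of_real_mult)
    then show ?thesis using False by simp
  qed simp
  have square: "\<exists>s d. (x - of_real s) * (x - of_real s) = of_real d" for x :: 'a
  proof -
    obtain t where t: "x + conjugate x = of_real t" using trace by blast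
    define s where "s = t / 2"
    have cx: "conjugate x = of_real s + of_real s - x"
      using t by (simp add: s_def algebra_simps flip: of_real_add)
    have "(x - of_real s) * (x - of_real s) = of_real s * of_real s - x * conjugate x"
      unfolding cx by (simp add: algebra_simps)
    also have "\<dots> = of_real (s * s - (norm x)\<^sup>2)" by (simp add: mult_conjugate)
    finally show ?thesis by blast
  qed
  have root: "\<exists>a. x = of_real a" if "x * x = of_real d" "d \<ge> 0" for x :: 'a and d
  proof -
    have "x * x = of_real (sqrt d) * of_real (sqrt d)"
      using that by (simp flip: of_real_mult)
    then have "x = of_real (sqrt d) \<or> x = of_real (- sqrt d)"
      unfolding of_real_minus by (rule square_eq_iff[THEN iffD1])
    then show ?thesis by blast
  qed
  show ?thesis
  proof (cases "\<forall>x :: 'a. \<exists>a. x = of_real a")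
    case True
    then have "conjugate x = x" for x :: 'a using conj_real by metis
    with True show ?thesis using real by blast
  next
    case False
    then obtain z :: 'a where z: "\<nexists>a. z = of_real a" by blast
    obtain s d where sd: "(z - of_real s) * (z - of_real s) = of_real d" using square by blast
    have "d < 0"
    proof (rule ccontr)
      assume "\<not> d < 0"
      with root[OF sd] obtain a where "z - of_real s = of_real a" by fastforce
      then have "z = of_real (a + s)" by (simp add: algebra_simps)
      with z show False by blast
    qed
    define j where "j = (z - of_real s) / of_real (sqrt (- d))"
    have sq: "of_real (sqrt (- d)) * of_real (sqrt (- d)) = (- of_real d :: 'a)"
      using \<open>d < 0\<close> by (simp flip: of_real_mult)
    have jj: "j * j = -1"
      using \<open>d < 0\<close> by (simp add: j_def sd sq)
    have "norm j * norm j = 1" using jj by (metis norm_minus_cancel norm_mult norm_one)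
    then have "j * conjugate j = j * (- j)"
      by (simp add: mult_conjugate jj power2_eq_square)
    moreover have "j \<noteq> 0" using jj by auto
    ultimately have cj: "conjugate j = - j" by (metis mult_left_cancel)
    have "\<exists>a b. x = of_real a + of_real b * j" for x :: 'a
    proof -
      obtain s d where sd: "(x - of_real s) * (x - of_real s) = of_real d" using square by blast
      have "((x - of_real s) * j) * ((x - of_real s) * j) = ((x - of_real s) * (x - of_real s)) * (j * j)"
        by (simp only: mult_ac)
      then have "((x - of_real s) * j) * ((x - of_real s) * j) = of_real (- d)"
        by (simp only: sd jj) simp
      then have "(\<exists>a. x - of_real s = of_real a) \<or> (\<exists>b. (x - of_real s) * j = of_real b)"
        using root[OF sd] root[of "(x - of_real s) * j" "- d"] by fastforce
      then show ?thesis
      proof (elim disjE exE)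
        fix a assume "x - of_real s = of_real a"
        then have "x = of_real (a + s) + of_real 0 * j" by (simp add: algebra_simps)
        then show ?thesis by blast
      next
        fix b assume b: "(x - of_real s) * j = of_real b"
        have "x - of_real s = - ((x - of_real s) * (j * j))" by (simp add: jj)
        also have "\<dots> = of_real (- b) * j" using b by (simp flip: mult.assoc)
        finally have "x = of_real s + of_real (- b) * j" by (simp add: algebra_simps)
        then show ?thesis by blast
      qed
    qed
    then show ?thesis using complex[OF jj cj] conj_real by blast
  qed
qed

text \<open>
  Matrix and vector indices start at 0, and \<open>x \<bullet>c y\<close> conjugates its second argument, so
  that \<open>x \<bullet>c y\<close> is the product \<open>y\<^sup>* x\<close> of a row and a column.
\<close>

definition unit_lower_triangular :: "'a :: {zero, one} mat \<Rightarrow> bool" where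
  "unit_lower_triangular L \<longleftrightarrow> dim_col L \<le> dim_row L \<and>
     (\<forall>j < dim_col L. L $$ (j, j) = 1) \<and>
     (\<forall>j < dim_col L. \<forall>i < j. L $$ (i, j) = 0)"

definition strictly_lower_nonzero :: "'a :: zero mat \<Rightarrow> bool" where
  "strictly_lower_nonzero M \<longleftrightarrow> (\<forall>i < dim_row M. \<forall>j < dim_col M. j < i \<longrightarrow> M $$ (i, j) \<noteq> 0)"

definition lu_factorization ::
    "nat \<Rightarrow> nat \<Rightarrow> 'a :: field mat \<Rightarrow> 'a mat \<Rightarrow> 'a mat \<Rightarrow> bool" where
  "lu_factorization n m X L U \<longleftrightarrow>
     L \<in> carrier_mat n m \<and> U \<in> carrier_mat m m \<and>
     unit_lower_triangular L \<and> upper_triangular U \<and> X = L * U"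

definition orthonormal_cols :: "'a :: conjugatable_field mat \<Rightarrow> bool" where
  "orthonormal_cols Q \<longleftrightarrow>
     (\<forall>i < dim_col Q. \<forall>j < dim_col Q. col Q j \<bullet>c col Q i = (if i = j then 1 else 0))"

definition qr_factorization ::
    "nat \<Rightarrow> nat \<Rightarrow> 'a :: conjugatable_field mat \<Rightarrow> 'a mat \<Rightarrow> 'a mat \<Rightarrow> bool" where
  "qr_factorization n m M Q R \<longleftrightarrow>
     Q \<in> carrier_mat n m \<and> R \<in> carrier_mat m m \<and>
     orthonormal_cols Q \<and> upper_triangular R \<and> M = Q * R"

end

(*
  The matrix W = V^* Q_k has orthonormal columns and W R_k = Lambda^k L U. Scaling the columns by
  D = diag(lambda_1, ..., lambda_m)^(-k) gives W = M T with M = Lambda^k L D, whose entries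
  L(i,j) (lambda_i / lambda_j)^k tend to those of the identity, and T upper triangular. Both T and
  S = T^(-1) = W^* M are bounded. Reading W = M T below the diagonal and W^* M = S above it shows
  that the off-diagonal entries of W tend to 0, so the diagonal entries of W, T and S tend to
  modulus 1, and the same two equations then give the leading coefficients. Since the columns of W
  are unit vectors, 1 - |W(j,j)|^2 is the sum of the other |W(i,j)|^2, which is dominated by the
  neighbours i = j - 1 and i = j + 1.
*)

theory Submission
  imports Defs
begin

text \<open>The QR factorizations carry no normalization of signs or phases: for each k a column of
  Q_k may be multiplied by a scalar of modulus 1 if R_k compensates. Hence T and S need not
  converge, and continuity of the QR factorization at the identity is of no help; what remains is
  boundedness and convergence of moduli. This fixes the order of the estimates: leading coefficients
  need |t(j,j)| and |s(j,j)| to tend to 1, which comes from the unit columns of W once its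
  off-diagonal entries tend to 0, and for this last fact boundedness of T and S suffices. Two
  equations are used because W = M T expresses an entry above the diagonal through entries of T
  whose size is not known in advance, whereas the zeros of S = W^* M below the diagonal are linear
  relations that give such entries at the correct rate. Solving them inverts the top block of M,
  which is how L(1:m,:)^(-1) enters.\<close>

section \<open>Entries of products, adjoints and triangular matrices\<close>

lemma index_mult_mat_sum:
  assumes "A \<in> carrier_mat n m" "B \<in> carrier_mat m p" "i < n" "j < p"
  shows "(A * B) $$ (i, j) = (\<Sum>q<m. A $$ (i, q) * B $$ (q, j))"
  using assms by (simp add: scalar_prod_def atLeast0LessThan)

lemma mat_adjoint_carrier: "A \<in> carrier_mat n m \<Longrightarrow> mat_adjoint A \<in> carrier_mat m n"
  by (auto simp: mat_adjoint_def)

lemma index_mat_adjoint: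
  "i < dim_col A \<Longrightarrow> j < dim_row A \<Longrightarrow> mat_adjoint A $$ (i, j) = conjugate (A $$ (j, i))"
  by (simp add: mat_adjoint_def mat_of_rows_def)

lemma mat_adjoint_mult:
  assumes A: "A \<in> carrier_mat n m" and B: "B \<in> carrier_mat m p"
  shows "mat_adjoint (A * B) = mat_adjoint B * mat_adjoint A"
proof (rule eq_matI)
  note adj = mat_adjoint_carrier[OF A] mat_adjoint_carrier[OF B]
  fix i j assume "i < dim_row (mat_adjoint B * mat_adjoint A)" "j < dim_col (mat_adjoint B * mat_adjoint A)"
  with adj have ij: "i < p" "j < n" by auto
  have "mat_adjoint (A * B) $$ (i, j) = conjugate (\<Sum>q<m. A $$ (j, q) * B $$ (q, i))"
    using A B ij by (subst index_mat_adjoint) (auto simp: index_mult_mat_sum[OF A B] simp del: index_mult_mat(1))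
  also have "\<dots> = (\<Sum>q<m. mat_adjoint B $$ (i, q) * mat_adjoint A $$ (q, j))"
    using A B ij
    by (simp add: sum_conjugate conjugate_dist_mul index_mat_adjoint mult.commute)
  also have "\<dots> = (mat_adjoint B * mat_adjoint A) $$ (i, j)"
    using index_mult_mat_sum[OF adj(2,1) ij] by simp
  finally show "mat_adjoint (A * B) $$ (i, j) = (mat_adjoint B * mat_adjoint A) $$ (i, j)" .
qed (use A B mat_adjoint_carrier[OF A] mat_adjoint_carrier[OF B] mat_adjoint_carrier[of "A * B" n p] in auto)

lemma mat_adjoint_adjoint: "mat_adjoint (mat_adjoint A) = A"
proof (rule eq_matI)
  have c: "mat_adjoint A \<in> carrier_mat (dim_col A) (dim_row A)"
    by (intro mat_adjoint_carrier) auto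
  from mat_adjoint_carrier[OF c]
  show "dim_row (mat_adjoint (mat_adjoint A)) = dim_row A"
    "dim_col (mat_adjoint (mat_adjoint A)) = dim_col A" by auto
  fix i j assume "i < dim_row A" "j < dim_col A"
  with c show "mat_adjoint (mat_adjoint A) $$ (i, j) = A $$ (i, j)"
    by (simp add: index_mat_adjoint)
qed

lemma orthonormal_cols_iff: "orthonormal_cols Q \<longleftrightarrow> mat_adjoint Q * Q = 1\<^sub>m (dim_col Q)"
proof -
  have Q: "Q \<in> carrier_mat (dim_row Q) (dim_col Q)" by simp
  note adj = mat_adjoint_carrier[OF Q]
  have "(mat_adjoint Q * Q) $$ (i, j) = col Q j \<bullet>c col Q i" if "i < dim_col Q" "j < dim_col Q" for i j
    using that index_mult_mat_sum[OF adj Q that]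
    by (simp add: index_mat_adjoint scalar_prod_def atLeast0LessThan mult.commute)
  then show ?thesis
    using adj unfolding orthonormal_cols_def by (auto simp: mat_eq_iff)
qed

lemma upper_triangular_mult:
  assumes A: "A \<in> carrier_mat m m" and B: "B \<in> carrier_mat m m"
    and "upper_triangular A" "upper_triangular B"
  shows "upper_triangular (A * B)"
proof (rule upper_triangularI)
  fix i j assume ji: "j < i" and "i < dim_row (A * B)"
  then have i: "i < m" using A by simp
  have "A $$ (i, q) * B $$ (q, j) = 0" if "q < m" for q
  proof (cases "q < i")
    case True
    then show ?thesis using assms i by (simp add: upper_triangularD)
  next
    case False
    with ji that show ?thesis using assms by (simp add: upper_triangularD)
  qed
  then show "(A * B) $$ (i, j) = 0"
    using ji i by (simp add: index_mult_mat_sum[OF A B])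
qed

lemma det_nonzero_obtain_inverse:
  fixes A :: "'a :: field mat"
  assumes "A \<in> carrier_mat n n" "det A \<noteq> 0"
  obtains B where "B \<in> carrier_mat n n" "A * B = 1\<^sub>m n" "B * A = 1\<^sub>m n"
  using det_non_zero_imp_unit[OF assms, of "()"] by (auto simp: Units_def ring_mat_def)

text \<open>Back substitution: rows of Z are treated from the bottom up, hence the induction on
  \<open>m - i\<close>. In row i of \<open>U * Z\<close> the terms with q < i vanish through U,
  those with q > i by induction, and the nonzero \<open>U $$ (i, i)\<close> cancels.\<close>

lemma upper_triangular_right_inverse:
  fixes U Z :: "'a :: field mat"
  assumes U: "U \<in> carrier_mat m m" and Z: "Z \<in> carrier_mat m m"
    and upper: "upper_triangular U" and UZ: "U * Z = 1\<^sub>m m"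
  shows "upper_triangular Z"
proof (rule upper_triangularI)
  have "det U * det Z = 1" using det_mult[OF U Z] UZ by simp
  then have diag: "U $$ (i, i) \<noteq> 0" if "i < m" for i
    using upper_triangular_imp_det_eq_0_iff[OF U upper] that U
    by (auto simp: diag_mat_def)
  fix i j assume "j < i" "i < dim_row Z"
  then have "i < m" using Z by simp
  then show "Z $$ (i, j) = 0" using \<open>j < i\<close>
  proof (induction "m - i" arbitrary: i rule: less_induct)
    case less
    have "(\<Sum>q<m. U $$ (i, q) * Z $$ (q, j)) = (\<Sum>q<m. if q = i then U $$ (i, i) * Z $$ (i, j) else 0)"
    proof (rule sum.cong[OF refl])
      fix q assume "q \<in> {..<m}"
      then show "U $$ (i, q) * Z $$ (q, j) = (if q = i then U $$ (i, i) * Z $$ (i, j) else 0)"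
        using less.hyps[of q] less.prems upper U by (cases q i rule: linorder_cases) auto
    qed
    then have "U $$ (i, i) * Z $$ (i, j) = (U * Z) $$ (i, j)"
      using less.prems by (simp add: index_mult_mat_sum[OF U Z])
    also have "\<dots> = 0" using less.prems by (simp add: UZ)
    finally show ?case using diag[OF less.prems(1)] by simp
  qed
qed

lemma upper_triangular_obtain_inverse:
  fixes U :: "'a :: field mat"
  assumes U: "U \<in> carrier_mat m m" "upper_triangular U" "det U \<noteq> 0"
  obtains Z where "Z \<in> carrier_mat m m" "upper_triangular Z" "U * Z = 1\<^sub>m m" "Z * U = 1\<^sub>m m"
  using det_nonzero_obtain_inverse[OF U(1,3)] upper_triangular_right_inverse[OF U(1) _ U(2)] by metis

section \<open>Leading blocks and the LU factorization\<close>

lemma pick_lessThan: "i < a \<Longrightarrow> pick {..<a} i = i"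
proof -
  assume "i < a"
  then have "{b \<in> {..<a}. b < i} = {..<i}" by auto
  with \<open>i < a\<close> pick_card_in_set[of i "{..<a}"] show ?thesis by simp
qed

lemma submatrix_lessThan:
  assumes "A \<in> carrier_mat n m" "a \<le> n"
  shows "b \<le> m \<Longrightarrow> submatrix A {..<a} {..<b} = mat a b (\<lambda>ij. A $$ ij)"
    and "submatrix A {..<a} UNIV = mat a m (\<lambda>ij. A $$ ij)"
proof -
  have "{i. i < dim_row A \<and> i \<in> {..<a}} = {..<a}" using assms by auto
  then have row: "card {i. i < dim_row A \<and> i \<in> {..<a}} = a" by simp
  have "{j. j < dim_col A \<and> j \<in> {..<b}} = {..<b}" if "b \<le> m" using assms(1) that by auto
  then have col: "card {j. j < dim_col A \<and> j \<in> {..<b}} = b" if "b \<le> m" using that by simp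
  have "{j. j < dim_col A \<and> j \<in> UNIV} = {..<m}" using assms(1) by auto
  then have col_UNIV: "card {j. j < dim_col A \<and> j \<in> UNIV} = m" by simp
  show "submatrix A {..<a} {..<b} = mat a b (\<lambda>ij. A $$ ij)" if "b \<le> m"
    unfolding submatrix_def row col[OF that] by (rule cong_mat) (simp_all add: pick_lessThan)
  show "submatrix A {..<a} UNIV = mat a m (\<lambda>ij. A $$ ij)"
    unfolding submatrix_def row col_UNIV by (rule cong_mat) (simp_all add: pick_lessThan pick_UNIV)
qed

lemma unit_lower_triangular_dims:
  "unit_lower_triangular L \<Longrightarrow> L \<in> carrier_mat n m \<Longrightarrow> m \<le> n"
  unfolding unit_lower_triangular_def by auto

lemma unit_lower_triangularD:
  assumes "unit_lower_triangular L" "L \<in> carrier_mat n m" "j < m"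
  shows "L $$ (j, j) = 1" and "i < j \<Longrightarrow> L $$ (i, j) = 0"
  using assms unfolding unit_lower_triangular_def by auto

lemma det_unit_lower:
  assumes L: "L \<in> carrier_mat n m" and "m \<le> n" "unit_lower_triangular L"
  shows "det (mat m m (\<lambda>ij. L $$ ij)) = 1"
proof -
  have "det (mat m m (\<lambda>ij. L $$ ij)) = prod_list (diag_mat (mat m m (\<lambda>ij. L $$ ij)))"
    using assms by (intro det_lower_triangular[of m]) (auto simp: unit_lower_triangular_def)
  also have "\<dots> = 1"
    using assms by (simp add: prod_list_diag_prod unit_lower_triangular_def)
  finally show ?thesis .
qed

lemma top_rows_mult:
  assumes A: "A \<in> carrier_mat n m" and B: "B \<in> carrier_mat m m" and "m \<le> n"
  shows "mat m m (\<lambda>ij. (A * B) $$ ij) = mat m m (\<lambda>ij. A $$ ij) * B"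
proof (rule eq_matI)
  fix i j assume "i < dim_row (mat m m (\<lambda>ij. A $$ ij) * B)" "j < dim_col (mat m m (\<lambda>ij. A $$ ij) * B)"
  with B have ij: "i < m" "j < m" by auto
  then show "mat m m (\<lambda>ij. (A * B) $$ ij) $$ (i, j) = (mat m m (\<lambda>ij. A $$ ij) * B) $$ (i, j)"
    using \<open>m \<le> n\<close> index_mult_mat_sum[of "mat m m (\<lambda>ij. A $$ ij)" m m B m i j] B
    by (simp add: index_mult_mat_sum[OF A B])
qed (use B in auto)

text \<open>A is rectangular, so multiplicativity of the determinant is applied to the top m rows; B
  acts on columns only and therefore commutes with taking these rows. This yields the invertibility
  of every triangular factor below.\<close>

lemma det_factor_of_top_rows:
  assumes A: "A \<in> carrier_mat n m" and B: "B \<in> carrier_mat m m" and "m \<le> n"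
    and "det (mat m m (\<lambda>ij. (A * B) $$ ij)) \<noteq> (0 :: 'a :: field)"
  shows "det B \<noteq> 0"
  using assms(4) det_mult[of "mat m m (\<lambda>ij. A $$ ij)" m B] B
  unfolding top_rows_mult[OF A B \<open>m \<le> n\<close>] by auto

text \<open>The inverse of U is constructed rather than U. That \<open>X * Z\<close> be unit lower
  triangular prescribes in column j only the rows 0 to j, and since Z is upper triangular only the
  leading block of X of size j + 1 is involved. The columns are thus separate linear systems, and no
  induction on the size is required.\<close>

lemma lu_factorization_exists:
  fixes X :: "'a :: field mat"
  assumes X: "X \<in> carrier_mat n m" and mn: "m \<le> n"
    and minors: "\<And>j. j \<in> {1..m} \<Longrightarrow> det (submatrix X {..<j} {..<j}) \<noteq> 0"
  shows "\<exists>L U. lu_factorization n m X L U"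
proof (cases "m = 0")
  case True
  then have "lu_factorization n m X (0\<^sub>m n 0) (0\<^sub>m 0 0)"
    using X by (auto simp: lu_factorization_def unit_lower_triangular_def)
  then show ?thesis by blast
next
  case False
  have "\<exists>C \<in> carrier_mat (Suc j) (Suc j). mat (Suc j) (Suc j) (\<lambda>ij. X $$ ij) * C = 1\<^sub>m (Suc j)" if "j < m" for j
  proof -
    have "det (mat (Suc j) (Suc j) (\<lambda>ij. X $$ ij)) \<noteq> 0"
      using minors[of "Suc j"] submatrix_lessThan(1)[OF X, of "Suc j" "Suc j"] that mn by simp
    then show ?thesis using det_nonzero_obtain_inverse[of "mat (Suc j) (Suc j) (\<lambda>ij. X $$ ij)" "Suc j"] by auto
  qed
  then obtain C where C: "\<And>j. j < m \<Longrightarrow> C j \<in> carrier_mat (Suc j) (Suc j)"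
    and XC: "\<And>j. j < m \<Longrightarrow> mat (Suc j) (Suc j) (\<lambda>ij. X $$ ij) * C j = 1\<^sub>m (Suc j)"
    by metis
  \<comment> \<open>Column \<open>j\<close> of \<open>Z = U\<^sup>-\<^sup>1\<close> is determined by \<open>X(1:j,1:j) z = e\<^sub>j\<close>.\<close>
  define Z where "Z = mat m m (\<lambda>(p, j). if p \<le> j then C j $$ (p, j) else 0)"
  have Z: "Z \<in> carrier_mat m m" by (simp add: Z_def)
  have upZ: "upper_triangular Z" by (auto simp: Z_def)
  have XZ: "(X * Z) $$ (i, j) = (if i = j then 1 else 0)" if "i \<le> j" "j < m" for i j
  proof -
    have "(X * Z) $$ (i, j) = (\<Sum>q<m. X $$ (i, q) * Z $$ (q, j))"
      using that mn by (simp add: index_mult_mat_sum[OF X Z])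
    also have "\<dots> = (\<Sum>q<Suc j. X $$ (i, q) * C j $$ (q, j))"
      using that by (intro sum.mono_neutral_cong_right) (auto simp: Z_def)
    also have "\<dots> = (mat (Suc j) (Suc j) (\<lambda>ij. X $$ ij) * C j) $$ (i, j)"
      using that C[of j] by (subst index_mult_mat_sum[of _ "Suc j" "Suc j" _ "Suc j"]) auto
    also have "\<dots> = (if i = j then 1 else 0)" using that by (simp add: XC)
    finally show ?thesis .
  qed
  have L: "X * Z \<in> carrier_mat n m" using X Z by simp
  have unitL: "unit_lower_triangular (X * Z)"
    using XZ mn X Z by (auto simp: unit_lower_triangular_def)
  \<comment> \<open>Z is assembled from columns of different inverses, so its invertibility is read
    off from the product: the top block of \<open>X * Z\<close> has determinant 1.\<close>
  have "det Z \<noteq> 0"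
    using det_factor_of_top_rows[OF X Z mn] det_unit_lower[OF L mn unitL] by simp
  from upper_triangular_obtain_inverse[OF Z upZ this] obtain U where
    U: "U \<in> carrier_mat m m" "upper_triangular U" "Z * U = 1\<^sub>m m" by metis
  have "X * Z * U = X * (Z * U)" using X Z U(1) by (rule assoc_mult_mat)
  then have XZU: "X = X * Z * U" using X U(3) by simp
  show ?thesis
    unfolding lu_factorization_def by (intro exI[of _ "X * Z"] exI[of _ U] conjI L unitL U XZU)
qed

text \<open>The core of uniqueness, applied to P = U' U^(-1). It is a forward substitution: on or
  above the diagonal of row i, terms with q < i vanish because the earlier rows of P are those of
  the identity, and terms with q > i because L is lower triangular, so \<open>L * P\<close> and P
  agree there.\<close>

lemma unit_lower_triangular_mult_upper_eq_one:
  fixes L P :: "'a :: field mat"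
  assumes L: "L \<in> carrier_mat n m" "unit_lower_triangular L" and P: "P \<in> carrier_mat m m" "upper_triangular P"
    and LP: "unit_lower_triangular (L * P)"
  shows "P = 1\<^sub>m m"
proof (rule eq_matI)
  have mn: "m \<le> n" using unit_lower_triangular_dims[OF L(2,1)] .
  have eq: "P $$ (i, j) = 1\<^sub>m m $$ (i, j)" if "i < m" "j < m" for i j
    using that
  proof (induction i arbitrary: j rule: less_induct)
    case (less i)
    show ?case
    proof (cases "j < i")
      case True
      with less.prems P show ?thesis by auto
    next
      case False
      have "(L * P) $$ (i, j) = (\<Sum>q<m. L $$ (i, q) * P $$ (q, j))"
        using less.prems mn by (simp add: index_mult_mat_sum[OF L(1) P(1)])
      also have "\<dots> = (\<Sum>q<m. if q = i then P $$ (i, j) else 0)"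
      proof (rule sum.cong[OF refl])
        fix q assume "q \<in> {..<m}"
        then have q: "q < m" by simp
        show "L $$ (i, q) * P $$ (q, j) = (if q = i then P $$ (i, j) else 0)"
        proof (cases q i rule: linorder_cases)
          case q_less: less
          then have "P $$ (q, j) = 0" using less.IH[of q j] less.prems False q by simp
          with q_less show ?thesis by simp
        next
          case equal
          then show ?thesis using unit_lower_triangularD[OF L(2,1) q] by simp
        next
          case greater
          then show ?thesis using unit_lower_triangularD[OF L(2,1) q] by simp
        qed
      qed
      also have "\<dots> = P $$ (i, j)" using less.prems by simp
      finally show ?thesis
        using False less.prems L(1) P(1)
          unit_lower_triangularD(1)[OF LP mult_carrier_mat[OF L(1) P(1)] less.prems(2)]
          unit_lower_triangularD(2)[OF LP mult_carrier_mat[OF L(1) P(1)] less.prems(2), of i]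
        by (cases "i = j") auto
    qed
  qed
  then show "\<And>i j. i < dim_row (1\<^sub>m m) \<Longrightarrow> j < dim_col (1\<^sub>m m) \<Longrightarrow> P $$ (i, j) = 1\<^sub>m m $$ (i, j)"
    by simp
qed (use P in auto)

lemma lu_factorization_det:
  assumes "lu_factorization n m X L U" "m \<le> n" "det (mat m m (\<lambda>ij. X $$ ij)) \<noteq> 0"
  shows "det U \<noteq> 0"
  using assms det_factor_of_top_rows[of L n m U] by (auto simp: lu_factorization_def)

lemma lu_factorization_unique:
  assumes LU: "lu_factorization n m X L U" and LU': "lu_factorization n m X L' U'" and mn: "m \<le> n"
    and det: "det (mat m m (\<lambda>ij. X $$ ij)) \<noteq> 0"
  shows "L = L' \<and> U = U'"
proof -
  have L: "L \<in> carrier_mat n m" "unit_lower_triangular L" and U: "U \<in> carrier_mat m m" "upper_triangular U"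
    and L': "L' \<in> carrier_mat n m" "unit_lower_triangular L'" and U': "U' \<in> carrier_mat m m" "upper_triangular U'"
    and eq: "L * U = L' * U'"
    using LU LU' by (auto simp: lu_factorization_def)
  obtain Z where Z: "Z \<in> carrier_mat m m" "upper_triangular Z" "U * Z = 1\<^sub>m m" "Z * U = 1\<^sub>m m"
    using upper_triangular_obtain_inverse[OF U lu_factorization_det[OF LU mn det]] by metis
  have "L = L * (U * Z)" using L Z by simp
  also have "\<dots> = L * U * Z" using L U Z by (simp add: assoc_mult_mat[of _ n m _ m])
  also have "\<dots> = L' * (U' * Z)" unfolding eq by (rule assoc_mult_mat[OF L'(1) U'(1) Z(1)])
  finally have LL': "L = L' * (U' * Z)" .
  have one: "U' * Z = 1\<^sub>m m"
  proof (rule unit_lower_triangular_mult_upper_eq_one[OF L'])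
    show "U' * Z \<in> carrier_mat m m" using U' Z by simp
    show "upper_triangular (U' * Z)" by (rule upper_triangular_mult[OF U'(1) Z(1) U'(2) Z(2)])
    show "unit_lower_triangular (L' * (U' * Z))" using L(2) unfolding LL' .
  qed
  have "U' = U' * (Z * U)" using U' Z by simp
  also have "\<dots> = U' * Z * U" using U' U Z by (simp add: assoc_mult_mat[of _ m m _ m])
  also have "\<dots> = U" using one U by simp
  finally have "U = U'" by simp
  moreover have "L = L'" using LL' L' unfolding one by simp
  ultimately show ?thesis by simp
qed

lemma mat_inverse_unit_lower:
  fixes L :: "'a :: field mat"
  assumes L: "L \<in> carrier_mat n m" "unit_lower_triangular L"
    and Linv: "Linv = the (mat_inverse (submatrix L {..<m} UNIV))"
  shows "Linv \<in> carrier_mat m m" and "mat m m (\<lambda>ij. L $$ ij) * Linv = 1\<^sub>m m"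
    and "Linv * mat m m (\<lambda>ij. L $$ ij) = 1\<^sub>m m"
    and "\<And>i j. i < j \<Longrightarrow> j < m \<Longrightarrow> Linv $$ (i, j) = 0"
proof -
  have mn: "m \<le> n" using unit_lower_triangular_dims[OF L(2,1)] .
  define T where "T = mat m m (\<lambda>ij. L $$ ij)"
  have T: "T \<in> carrier_mat m m" by (simp add: T_def)
  have "det T \<noteq> 0" using det_unit_lower[OF L(1) mn L(2)] by (simp add: T_def)
  from det_non_zero_imp_unit[OF T this] mat_inverse(1)[OF T]
  obtain B where B: "mat_inverse T = Some B" by fastforce
  then have "Linv = B"
    using submatrix_lessThan(2)[OF L(1) mn] by (simp add: Linv T_def)
  with mat_inverse(2)[OF T B]
  have inv: "Linv \<in> carrier_mat m m" "T * Linv = 1\<^sub>m m" "Linv * T = 1\<^sub>m m" by auto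
  then show "Linv \<in> carrier_mat m m" "mat m m (\<lambda>ij. L $$ ij) * Linv = 1\<^sub>m m"
    "Linv * mat m m (\<lambda>ij. L $$ ij) = 1\<^sub>m m" by (auto simp: T_def)
  \<comment> \<open>Transposition reduces the lower triangular case to the result on upper
    triangular inverses and reverses the product, so the left inverse becomes a right
    inverse.\<close>
  have "upper_triangular (transpose_mat Linv)"
  proof (rule upper_triangular_right_inverse)
    show "upper_triangular (transpose_mat T)"
      using unit_lower_triangularD[OF L(2,1)] by (auto simp: T_def)
    show "transpose_mat T * transpose_mat Linv = 1\<^sub>m m"
      using transpose_mult[OF inv(1) T] inv(3) by simp
  qed (use T inv in auto)
  then show "Linv $$ (i, j) = 0" if "i < j" "j < m" for i j
    using that inv(1) upper_triangularD[of "transpose_mat Linv" i j] by simp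
qed

section \<open>From a QR factorization to the triangular factors S and T\<close>

text \<open>The matrix S = R U^(-1) is triangular by construction and equals W^* M by
  orthonormality, because W S = M. The top block of M has determinant 1, which makes S nonsingular;
  T is its inverse.\<close>

lemma orthonormal_triangular_factors:
  fixes W M R U :: "'a :: conjugatable_field mat"
  assumes W: "W \<in> carrier_mat n m" "mat_adjoint W * W = 1\<^sub>m m"
    and R: "R \<in> carrier_mat m m" "upper_triangular R"
    and M: "M \<in> carrier_mat n m" "unit_lower_triangular M"
    and U: "U \<in> carrier_mat m m" "upper_triangular U" "det U \<noteq> 0"
    and eq: "W * R = M * U"
  shows "upper_triangular (mat_adjoint W * M)"
    and "\<exists>T. T \<in> carrier_mat m m \<and> upper_triangular T \<and> W = M * T"
proof -
  have mn: "m \<le> n" using unit_lower_triangular_dims[OF M(2,1)] .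
  obtain Z where Z: "Z \<in> carrier_mat m m" "upper_triangular Z" "U * Z = 1\<^sub>m m"
    using upper_triangular_obtain_inverse[OF U] by metis
  define S where "S = R * Z"
  have S: "S \<in> carrier_mat m m" "upper_triangular S"
    using R Z by (auto simp: S_def intro: upper_triangular_mult)
  have "W * S = W * R * Z" using W R Z by (simp add: S_def assoc_mult_mat[of _ n m _ m])
  also have "\<dots> = M * (U * Z)" unfolding eq using M U Z by (simp add: assoc_mult_mat[of _ n m _ m])
  also have "\<dots> = M" using M Z by simp
  finally have WS: "W * S = M" .
  have "S = mat_adjoint W * W * S" using W S by simp
  also have "\<dots> = mat_adjoint W * (W * S)"
    by (rule assoc_mult_mat[OF mat_adjoint_carrier[OF W(1)] W(1) S(1)])
  finally have S_eq: "S = mat_adjoint W * M" by (simp add: WS)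
  have "det S \<noteq> 0"
    using det_factor_of_top_rows[OF W(1) S(1) mn] det_unit_lower[OF M(1) mn M(2)] WS by simp
  then obtain T where T: "T \<in> carrier_mat m m" "upper_triangular T" "S * T = 1\<^sub>m m"
    using upper_triangular_obtain_inverse[OF S] by metis
  have "M * T = W * (S * T)" using W S T by (simp flip: WS add: assoc_mult_mat[of _ n m _ m])
  then have "W = M * T" using W T by simp
  with T(1,2) show "\<exists>T. T \<in> carrier_mat m m \<and> upper_triangular T \<and> W = M * T" by blast
  show "upper_triangular (mat_adjoint W * M)" using S(2) unfolding S_eq .
qed

lemma unitary_conjugate_diag_pow:
  assumes V: "V \<in> carrier_mat n n" and VV: "mat_adjoint V * V = 1\<^sub>m n" "V * mat_adjoint V = 1\<^sub>m n"
  shows "mat_adjoint V * (V * mat_diag n f * mat_adjoint V) ^\<^sub>m k = mat_diag n (\<lambda>i. f i ^ k) * mat_adjoint V"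
proof (induction k)
  note V' = mat_adjoint_carrier[OF V]
  case 0
  then show ?case using V V' by simp
next
  note V' = mat_adjoint_carrier[OF V]
  case (Suc k)
  let ?D = "mat_diag n f" and ?E = "mat_diag n (\<lambda>i. f i ^ k)"
  let ?A = "V * ?D * mat_adjoint V"
  have D: "?D \<in> carrier_mat n n" and E: "?E \<in> carrier_mat n n" by simp_all
  have DV: "?D * mat_adjoint V \<in> carrier_mat n n" by (rule mult_carrier_mat[OF D V'])
  have A: "?A \<in> carrier_mat n n" using V V' by auto
  have "mat_adjoint V * ?A ^\<^sub>m Suc k = mat_adjoint V * ?A ^\<^sub>m k * ?A"
    using assoc_mult_mat[OF V' pow_carrier_mat[OF A] A, of k] by simp
  also have "\<dots> = ?E * (mat_adjoint V * ?A)"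
    unfolding Suc.IH by (rule assoc_mult_mat[OF E V' A])
  also have "mat_adjoint V * ?A = mat_adjoint V * (V * (?D * mat_adjoint V))"
    using assoc_mult_mat[OF V D V'] by simp
  also have "\<dots> = mat_adjoint V * V * (?D * mat_adjoint V)"
    using assoc_mult_mat[OF V' V DV] by simp
  also have "\<dots> = ?D * mat_adjoint V" unfolding VV(1) by (rule left_mult_one_mat[OF DV])
  also have "?E * (?D * mat_adjoint V) = ?E * ?D * mat_adjoint V"
    using assoc_mult_mat[OF E D V'] by simp
  finally show ?case by (simp add: mult.commute)
qed


section \<open>Entrywise asymptotics: tools and setting\<close>

lemma norm_conjugate: "norm (conjugate x) = norm (x :: 'a :: real_or_complex_field)"
proof (cases "x = 0")
  case False
  have "norm x * norm (conjugate x) = (norm x)\<^sup>2"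
    by (metis mult_conjugate norm_mult norm_of_real abs_power2)
  with False show ?thesis by (simp add: power2_eq_square)
qed simp

lemma tendsto_zero_mult_bigo:
  fixes f g :: "'b \<Rightarrow> 'a :: real_normed_field"
  assumes "(f \<longlongrightarrow> 0) F" and "g \<in> O[F](\<lambda>_. 1)"
  shows "((\<lambda>x. f x * g x) \<longlongrightarrow> 0) F"
proof -
  have "f \<in> o[F](\<lambda>_. 1)" using assms(1) by (intro smalloI_tendsto) simp_all
  from landau_o.small_big_mult[OF this assms(2)]
  have "(\<lambda>x. f x * g x) \<in> o[F](\<lambda>_. 1)" by simp
  from smalloD_tendsto[OF this] show ?thesis by simp
qed

text \<open>
  \<open>l\<close> and \<open>li\<close> are \<open>L\<close> and \<open>(L(1:m,:))\<^sup>-\<^sup>1\<close>, and \<open>w k\<close> is \<open>V\<^sup>* Q\<^sub>k\<close>. With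
  \<open>M\<^sub>k = \<Lambda>\<^sup>k L diag(\<lambda>\<^sub>1, \<dots>, \<lambda>\<^sub>m)\<^sup>-\<^sup>k\<close>, the assumptions on \<open>s\<close> and \<open>t\<close> say that \<open>s k = (w k)\<^sup>* M\<^sub>k\<close> and
  \<open>t k\<close> are upper triangular and that \<open>w k = M\<^sub>k (t k)\<close>.
\<close>

locale qr_of_scaled_lu =
  fixes n m :: nat and lam :: "nat \<Rightarrow> 'a :: real_or_complex_field"
    and l li :: "nat \<Rightarrow> nat \<Rightarrow> 'a" and w s t :: "nat \<Rightarrow> nat \<Rightarrow> nat \<Rightarrow> 'a"
  assumes m_le_n: "m \<le> n"
    and lam_less: "\<And>i j. i < j \<Longrightarrow> j < n \<Longrightarrow> norm (lam j) < norm (lam i)"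
    and lam_nonzero: "\<And>i. i < n \<Longrightarrow> lam i \<noteq> 0"
    and l_diag: "\<And>j. j < m \<Longrightarrow> l j j = 1"
    and l_upper: "\<And>i j. i < j \<Longrightarrow> j < m \<Longrightarrow> l i j = 0"
    and li_upper: "\<And>i j. i < j \<Longrightarrow> j < m \<Longrightarrow> li i j = 0"
    and l_li: "\<And>i j. i < m \<Longrightarrow> j < m \<Longrightarrow> (\<Sum>p<m. l i p * li p j) = (if i = j then 1 else 0)"
    and li_l: "\<And>i j. i < m \<Longrightarrow> j < m \<Longrightarrow> (\<Sum>p<m. li i p * l p j) = (if i = j then 1 else 0)"
    and w_unit: "\<And>k j. 1 \<le> k \<Longrightarrow> j < m \<Longrightarrow> (\<Sum>i<n. (norm (w k i j))\<^sup>2) = 1"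
    and w_eq: "\<And>k i j. 1 \<le> k \<Longrightarrow> i < n \<Longrightarrow> j < m \<Longrightarrow>
      w k i j = (\<Sum>p<m. l i p * (lam i / lam p) ^ k * t k p j)"
    and t_lower: "\<And>k i j. 1 \<le> k \<Longrightarrow> j < i \<Longrightarrow> i < m \<Longrightarrow> t k i j = 0"
    and s_eq: "\<And>k i j. 1 \<le> k \<Longrightarrow> i < m \<Longrightarrow> j < m \<Longrightarrow>
      s k j i = (\<Sum>p<n. conjugate (w k p j) * (l p i * (lam p / lam i) ^ k))"
    and s_lower: "\<And>k i j. 1 \<le> k \<Longrightarrow> j < i \<Longrightarrow> i < m \<Longrightarrow> s k i j = 0"
begin

section \<open>Eigenvalue ratios and boundedness\<close>

abbreviation \<rho> :: "nat \<Rightarrow> nat \<Rightarrow> nat \<Rightarrow> 'a" where "\<rho> k i j \<equiv> (lam i / lam j) ^ k"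

lemma rho_mult: "i < n \<Longrightarrow> j < n \<Longrightarrow> p < n \<Longrightarrow> \<rho> k i j * \<rho> k j p = \<rho> k i p"
  using lam_nonzero[of j] by (simp flip: power_mult_distrib)

lemma rho_refl: "i < n \<Longrightarrow> \<rho> k i i = 1"
  using lam_nonzero[of i] by simp

lemma rho_tendsto: "j < i \<Longrightarrow> i < n \<Longrightarrow> (\<lambda>k. \<rho> k i j) \<longlonglongrightarrow> 0"
  using lam_less[of j i] lam_nonzero[of j]
  by (intro LIMSEQ_power_zero) (simp add: norm_divide divide_less_eq)

lemma rho_bounded: "j \<le> i \<Longrightarrow> i < n \<Longrightarrow> (\<lambda>k. \<rho> k i j) \<in> O(\<lambda>_. 1)"
proof (cases "j = i")
  case False
  assume "j \<le> i" "i < n"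
  with False have "(\<lambda>k. \<rho> k i j) \<longlonglongrightarrow> 0" by (intro rho_tendsto) auto
  then show ?thesis by (intro bigoI_tendsto[where c = 0]) simp_all
qed (use rho_refl[of i] in simp)

lemma w_bounded: assumes "i < n" "j < m" shows "(\<lambda>k. w k i j) \<in> O(\<lambda>_. 1)"
proof (rule bigoI[where c = 1], rule eventually_sequentiallyI[of 1])
  fix k :: nat assume "1 \<le> k"
  have "(norm (w k i j))\<^sup>2 \<le> (\<Sum>i<n. (norm (w k i j))\<^sup>2)"
    using assms by (intro member_le_sum) auto
  also have "\<dots> = 1\<^sup>2" using w_unit[OF \<open>1 \<le> k\<close> \<open>j < m\<close>] by simp
  finally show "norm (w k i j) \<le> 1 * norm (1 :: 'a)"
    by (simp add: abs_square_le_1)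
qed

lemma conjugate_w_bounded: "i < n \<Longrightarrow> j < m \<Longrightarrow> (\<lambda>k. conjugate (w k i j)) \<in> O(\<lambda>_. 1)"
  using w_bounded[of i j] by (simp add: bigo_def norm_conjugate)

lemma bounded_mult:
  fixes f g :: "nat \<Rightarrow> 'a"
  shows "f \<in> O(\<lambda>_. 1) \<Longrightarrow> g \<in> O(\<lambda>_. 1) \<Longrightarrow> (\<lambda>k. f k * g k) \<in> O(\<lambda>_. 1)"
  using landau_o.big_mult[of f sequentially "\<lambda>_. 1" g "\<lambda>_. 1"] by simp

text \<open>
  The top block of \<open>w k = M\<^sub>k (t k)\<close> expresses \<open>t k\<close> through \<open>w k\<close>, and the inverse of the top
  block of \<open>M\<^sub>k\<close> is bounded; this avoids estimating the inverse of \<open>s k\<close>.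
\<close>

lemma t_eq:
  assumes "1 \<le> k" "p < m" "j < m"
  shows "t k p j = (\<Sum>q<m. li p q * \<rho> k p q * w k q j)"
proof -
  have "(\<Sum>q<m. li p q * \<rho> k p q * w k q j) =
      (\<Sum>q<m. \<Sum>r<m. li p q * l q r * \<rho> k p r * t k r j)"
  proof (rule sum.cong[OF refl])
    fix q assume q: "q \<in> {..<m}"
    have rho: "\<rho> k p r = \<rho> k p q * \<rho> k q r" if "r < m" for r
      using q that assms m_le_n by (intro rho_mult[symmetric]) auto
    have w: "w k q j = (\<Sum>r<m. l q r * \<rho> k q r * t k r j)"
      using q assms m_le_n by (intro w_eq) auto
    show "li p q * \<rho> k p q * w k q j = (\<Sum>r<m. li p q * l q r * \<rho> k p r * t k r j)"
      unfolding w sum_distrib_left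
    proof (rule sum.cong[OF refl])
      fix r assume "r \<in> {..<m}"
      then have "r < m" by simp
      show "li p q * \<rho> k p q * (l q r * \<rho> k q r * t k r j) = li p q * l q r * \<rho> k p r * t k r j"
        unfolding rho[OF \<open>r < m\<close>] by (simp only: mult_ac)
    qed
  qed
  also have "\<dots> = (\<Sum>r<m. (\<Sum>q<m. li p q * l q r) * (\<rho> k p r * t k r j))"
    by (subst sum.swap) (simp only: sum_distrib_right mult.assoc)
  also have "\<dots> = (\<Sum>r<m. if p = r then \<rho> k p r * t k r j else 0)"
    using assms by (intro sum.cong) (simp_all add: li_l)
  also have "\<dots> = t k p j"
    using assms m_le_n rho_refl[of p k] by (simp add: sum.delta)
  finally show ?thesis by simp
qed

text \<open>In \<open>t_eq\<close> the factor \<open>li p q\<close> leaves only the indices q \<le>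
  p, and for these \<open>\<rho> k p q\<close> is bounded.\<close>

lemma t_bounded: assumes "p < m" "j < m" shows "(\<lambda>k. t k p j) \<in> O(\<lambda>_. 1)"
proof -
  have "(\<lambda>k. \<Sum>q<m. li p q * \<rho> k p q * w k q j) \<in> O(\<lambda>_. 1)"
  proof (rule big_sum_in_bigo)
    fix q assume q: "q \<in> {..<m}"
    show "(\<lambda>k. li p q * \<rho> k p q * w k q j) \<in> O(\<lambda>_. 1)"
    proof (cases "p < q")
      case True
      then show ?thesis using li_upper[of p q] q by simp
    next
      case False
      then show ?thesis
        using q assms m_le_n by (intro bounded_mult rho_bounded w_bounded) auto
    qed
  qed
  then show ?thesis
    by (rule landau_o.big.in_cong[THEN iffD1, rotated])
      (use t_eq assms in \<open>auto intro: eventually_sequentiallyI[of 1]\<close>)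
qed

text \<open>Here \<open>l p i\<close> removes the indices p < i, the only ones whose ratio
  \<open>\<rho> k p i\<close> would grow.\<close>

lemma s_bounded: assumes "i < m" "j < m" shows "(\<lambda>k. s k j i) \<in> O(\<lambda>_. 1)"
proof -
  have "(\<lambda>k. \<Sum>p<n. conjugate (w k p j) * (l p i * \<rho> k p i)) \<in> O(\<lambda>_. 1)"
  proof (rule big_sum_in_bigo)
    fix p assume p: "p \<in> {..<n}"
    show "(\<lambda>k. conjugate (w k p j) * (l p i * \<rho> k p i)) \<in> O(\<lambda>_. 1)"
    proof (cases "p < i")
      case True
      then show ?thesis using l_upper[of p i] assms by simp
    next
      case False
      then show ?thesis
        using p assms m_le_n by (intro bounded_mult rho_bounded conjugate_w_bounded) auto
    qed
  qed
  then show ?thesis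
    by (rule landau_o.big.in_cong[THEN iffD1, rotated])
      (use s_eq assms in \<open>auto intro: eventually_sequentiallyI[of 1]\<close>)
qed

section \<open>Limits of the rescaled entries\<close>

text \<open>Multiplying \<open>w_eq\<close> by \<open>\<rho> k j i\<close> replaces each ratio by
  \<open>\<rho> k j p\<close>, independent of i. Terms with p > j vanish since T is upper
  triangular, terms with p < j decay, and p = j survives. The case i = j links the diagonals of W
  and T; i > j gives the leading coefficient.\<close>

lemma w_lower_tendsto:
  assumes "i < n" "j < m"
  shows "(\<lambda>k. w k i j * \<rho> k j i - l i j * t k j j) \<longlonglongrightarrow> 0"
proof -
  have "(\<lambda>k. \<Sum>p\<in>{..<m} - {j}. \<rho> k j p * (l i p * t k p j)) \<longlonglongrightarrow> 0"
  proof (rule tendsto_null_sum)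
    fix p assume p: "p \<in> {..<m} - {j}"
    show "(\<lambda>k. \<rho> k j p * (l i p * t k p j)) \<longlonglongrightarrow> 0"
    proof (cases "p < j")
      case True
      with p assms m_le_n show ?thesis
        by (intro tendsto_zero_mult_bigo rho_tendsto bounded_mult t_bounded) auto
    next
      case False
      then have "eventually (\<lambda>k. \<rho> k j p * (l i p * t k p j) = 0) sequentially"
        using p t_lower[of _ j p] by (intro eventually_sequentiallyI[of 1]) auto
      then show ?thesis by (rule tendsto_eventually)
    qed
  qed
  moreover have "eventually (\<lambda>k. (\<Sum>p\<in>{..<m} - {j}. \<rho> k j p * (l i p * t k p j)) =
      w k i j * \<rho> k j i - l i j * t k j j) sequentially"
  proof (rule eventually_sequentiallyI[of 1])
    fix k :: nat assume k: "1 \<le> k"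
    have "w k i j * \<rho> k j i = (\<Sum>p<m. \<rho> k j p * (l i p * t k p j))"
      unfolding w_eq[OF k assms] sum_distrib_right
    proof (rule sum.cong[OF refl])
      fix p assume "p \<in> {..<m}"
      then have rho: "\<rho> k j p = \<rho> k j i * \<rho> k i p"
        using assms m_le_n by (intro rho_mult[symmetric]) auto
      show "l i p * \<rho> k i p * t k p j * \<rho> k j i = \<rho> k j p * (l i p * t k p j)"
        unfolding rho by (simp only: mult_ac)
    qed
    also have "\<dots> = \<rho> k j j * (l i j * t k j j) + (\<Sum>p\<in>{..<m} - {j}. \<rho> k j p * (l i p * t k p j))"
      using assms by (intro sum.remove) auto
    finally show "(\<Sum>p\<in>{..<m} - {j}. \<rho> k j p * (l i p * t k p j)) =
        w k i j * \<rho> k j i - l i j * t k j j"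
      using rho_refl[of j k] assms m_le_n by simp
  qed
  ultimately show ?thesis by (rule Lim_transform_eventually)
qed

text \<open>
  Row \<open>j\<close> of \<open>s k = (w k)\<^sup>* M\<^sub>k\<close> times the inverse of the top block of \<open>M\<^sub>k\<close>, rescaled so that
  every ratio of eigenvalues that survives triangularity is at most 1 in absolute value.
\<close>

lemma conjugate_w_eq:
  assumes k: "1 \<le> k" and "i < m" "j < m"
  shows "(\<Sum>q<m. s k j q * (li q i * \<rho> k q j)) -
      (\<Sum>p\<in>{m..<n}. conjugate (w k p j) * (\<rho> k p j * (\<Sum>q<m. l p q * li q i)))
    = conjugate (w k i j) * \<rho> k i j"
proof -
  have "(\<Sum>q<m. s k j q * (li q i * \<rho> k q j)) =
      (\<Sum>q<m. \<Sum>p<n. conjugate (w k p j) * \<rho> k p j * (l p q * li q i))"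
  proof (rule sum.cong[OF refl])
    fix q assume q: "q \<in> {..<m}"
    have s: "s k j q = (\<Sum>p<n. conjugate (w k p j) * (l p q * \<rho> k p q))"
      using q assms by (intro s_eq) auto
    show "s k j q * (li q i * \<rho> k q j) = (\<Sum>p<n. conjugate (w k p j) * \<rho> k p j * (l p q * li q i))"
      unfolding s sum_distrib_right
    proof (rule sum.cong[OF refl])
      fix p assume "p \<in> {..<n}"
      then have rho: "\<rho> k p j = \<rho> k p q * \<rho> k q j"
        using q assms m_le_n by (intro rho_mult[symmetric]) auto
      show "conjugate (w k p j) * (l p q * \<rho> k p q) * (li q i * \<rho> k q j) =
          conjugate (w k p j) * \<rho> k p j * (l p q * li q i)"
        unfolding rho by (simp only: mult_ac)
    qed
  qed
  also have "\<dots> = (\<Sum>p<n. conjugate (w k p j) * (\<rho> k p j * (\<Sum>q<m. l p q * li q i)))"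
    by (subst sum.swap) (simp add: sum_distrib_left mult_ac)
  \<comment> \<open>Only the top m rows of L are inverted by \<open>li\<close>. The rows p \<ge> m
    of the rectangular factor remain as a correction term.\<close>
  also have "{..<n} = {..<m} \<union> {m..<n}" using m_le_n by auto
  also have "(\<Sum>p\<in>\<dots>. conjugate (w k p j) * (\<rho> k p j * (\<Sum>q<m. l p q * li q i))) =
      (\<Sum>p<m. conjugate (w k p j) * (\<rho> k p j * (\<Sum>q<m. l p q * li q i))) +
      (\<Sum>p\<in>{m..<n}. conjugate (w k p j) * (\<rho> k p j * (\<Sum>q<m. l p q * li q i)))"
    by (intro sum.union_disjoint) auto
  also have "(\<Sum>p<m. conjugate (w k p j) * (\<rho> k p j * (\<Sum>q<m. l p q * li q i))) =
      (\<Sum>p<m. if i = p then conjugate (w k p j) * \<rho> k p j else 0)"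
    using assms by (intro sum.cong) (simp_all add: l_li)
  also have "\<dots> = conjugate (w k i j) * \<rho> k i j"
    using assms by simp
  finally show ?thesis by simp
qed

text \<open>In the sum over q, terms with q < j vanish since S is upper triangular, terms with q > j
  decay, and q = j leaves the entry \<open>li j i\<close> of the inverse. The conjugate stems from
  the adjoint in S = W^* M and disappears on taking norms.\<close>

lemma w_upper_tendsto:
  assumes "i < m" "j < m"
  shows "(\<lambda>k. conjugate (w k i j) * \<rho> k i j - s k j j * li j i) \<longlonglongrightarrow> 0"
proof -
  have 1: "(\<lambda>k. \<Sum>q\<in>{..<m} - {j}. \<rho> k q j * (s k j q * li q i)) \<longlonglongrightarrow> 0"
  proof (rule tendsto_null_sum)
    fix q assume q: "q \<in> {..<m} - {j}"
    show "(\<lambda>k. \<rho> k q j * (s k j q * li q i)) \<longlonglongrightarrow> 0"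
    proof (cases "j < q")
      case True
      with q assms m_le_n show ?thesis
        by (intro tendsto_zero_mult_bigo rho_tendsto bounded_mult s_bounded) auto
    next
      case False
      then have "eventually (\<lambda>k. \<rho> k q j * (s k j q * li q i) = 0) sequentially"
        using q s_lower[of _ q j] assms by (intro eventually_sequentiallyI[of 1]) auto
      then show ?thesis by (rule tendsto_eventually)
    qed
  qed
  \<comment> \<open>The correction from the rows p \<ge> m decays as well, because j < m \<le>
    p.\<close>
  have 2: "(\<lambda>k. \<Sum>p\<in>{m..<n}. \<rho> k p j * (conjugate (w k p j) * (\<Sum>q<m. l p q * li q i))) \<longlonglongrightarrow> 0"
    using assms
    by (intro tendsto_null_sum tendsto_zero_mult_bigo rho_tendsto bounded_mult conjugate_w_bounded)
      auto
  have "eventually (\<lambda>k. (\<Sum>q\<in>{..<m} - {j}. \<rho> k q j * (s k j q * li q i)) -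
      (\<Sum>p\<in>{m..<n}. \<rho> k p j * (conjugate (w k p j) * (\<Sum>q<m. l p q * li q i))) =
      conjugate (w k i j) * \<rho> k i j - s k j j * li j i) sequentially"
  proof (rule eventually_sequentiallyI[of 1])
    fix k :: nat assume k: "1 \<le> k"
    have "(\<Sum>q<m. s k j q * (li q i * \<rho> k q j)) =
        s k j j * (li j i * \<rho> k j j) + (\<Sum>q\<in>{..<m} - {j}. s k j q * (li q i * \<rho> k q j))"
      using assms by (intro sum.remove) auto
    then show "(\<Sum>q\<in>{..<m} - {j}. \<rho> k q j * (s k j q * li q i)) -
      (\<Sum>p\<in>{m..<n}. \<rho> k p j * (conjugate (w k p j) * (\<Sum>q<m. l p q * li q i))) =
      conjugate (w k i j) * \<rho> k i j - s k j j * li j i"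
      using conjugate_w_eq[OF k assms] rho_refl[of j k] assms m_le_n
      by (simp add: algebra_simps)
  qed
  with tendsto_diff[OF 1 2] show ?thesis by (simp add: Lim_transform_eventually)
qed

section \<open>Off-diagonal decay and moduli of the diagonal entries\<close>

lemma li_diag: assumes "j < m" shows "li j j = 1"
proof -
  have "(\<Sum>p<m. l j p * li p j) = (\<Sum>p<m. if p = j then li j j else 0)"
  proof (rule sum.cong[OF refl])
    fix p assume "p \<in> {..<m}"
    with assms show "l j p * li p j = (if p = j then li j j else 0)"
      using l_upper[of j p] li_upper[of p j] l_diag[of j] by (cases p j rule: linorder_cases) auto
  qed
  with l_li[OF assms assms] assms show ?thesis by simp
qed

text \<open>The two preceding limits show that the entry stays bounded even after multiplication by
  a growing ratio; multiplying back by the reciprocal, decaying ratio gives 0. Only boundedness of T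
  and S enters, so nothing about their diagonals is presupposed.\<close>

lemma w_off_diag_tendsto:
  assumes "i < n" "j < m" "i \<noteq> j"
  shows "(\<lambda>k. w k i j) \<longlonglongrightarrow> 0"
proof (cases "j < i")
  case True
  have diff: "(\<lambda>k. w k i j * \<rho> k j i - l i j * t k j j) \<in> O(\<lambda>_. 1)"
    using w_lower_tendsto[OF assms(1,2)] by (intro bigoI_tendsto[where c = 0]) simp_all
  have t: "(\<lambda>k. l i j * t k j j) \<in> O(\<lambda>_. 1)"
    using assms by (intro bounded_mult t_bounded) auto
  from sum_in_bigo(1)[OF diff t] have "(\<lambda>k. w k i j * \<rho> k j i) \<in> O(\<lambda>_. 1)" by simp
  then have "(\<lambda>k. \<rho> k i j * (w k i j * \<rho> k j i)) \<longlonglongrightarrow> 0"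
    using True assms by (intro tendsto_zero_mult_bigo rho_tendsto) auto
  moreover have "\<rho> k i j * (w k i j * \<rho> k j i) = w k i j" for k
    using rho_mult[of i j i k] rho_refl[of i k] assms m_le_n by (simp add: mult_ac)
  ultimately show ?thesis by simp
next
  case False
  with assms m_le_n have ij: "i < m" "i < j" "j < n" by auto
  have diff: "(\<lambda>k. conjugate (w k i j) * \<rho> k i j - s k j j * li j i) \<in> O(\<lambda>_. 1)"
    using w_upper_tendsto[OF ij(1) assms(2)] by (intro bigoI_tendsto[where c = 0]) simp_all
  have s: "(\<lambda>k. s k j j * li j i) \<in> O(\<lambda>_. 1)"
    using assms by (intro bounded_mult s_bounded) auto
  from sum_in_bigo(1)[OF diff s] have "(\<lambda>k. conjugate (w k i j) * \<rho> k i j) \<in> O(\<lambda>_. 1)" by simp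
  then have "(\<lambda>k. \<rho> k j i * (conjugate (w k i j) * \<rho> k i j)) \<longlonglongrightarrow> 0"
    using ij by (intro tendsto_zero_mult_bigo rho_tendsto) auto
  moreover have "\<rho> k j i * (conjugate (w k i j) * \<rho> k i j) = conjugate (w k i j)" for k
    using rho_mult[of i j i k] rho_refl[of i k] assms ij by (simp add: mult_ac)
  ultimately have "(\<lambda>k. norm (conjugate (w k i j))) \<longlonglongrightarrow> 0"
    by (simp add: tendsto_norm_zero)
  then show ?thesis by (simp add: norm_conjugate tendsto_norm_zero_iff)
qed

lemma norm_w_diag_sq:
  assumes "1 \<le> k" "j < m"
  shows "1 - (norm (w k j j))\<^sup>2 = (\<Sum>i\<in>{..<n} - {j}. (norm (w k i j))\<^sup>2)"
  using w_unit[OF assms] sum.remove[of "{..<n}" j "\<lambda>i. (norm (w k i j))\<^sup>2"] assms m_le_n by simp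

lemma norm_w_diag_tendsto:
  assumes "j < m"
  shows "(\<lambda>k. norm (w k j j)) \<longlonglongrightarrow> 1"
proof -
  have "(\<lambda>k. 1 - (\<Sum>i\<in>{..<n} - {j}. (norm (w k i j))\<^sup>2)) \<longlonglongrightarrow> 1 - (\<Sum>i\<in>{..<n} - {j}. (norm (0::'a))\<^sup>2)"
    using assms by (intro tendsto_intros w_off_diag_tendsto) auto
  then have "(\<lambda>k. sqrt (1 - (\<Sum>i\<in>{..<n} - {j}. (norm (w k i j))\<^sup>2))) \<longlonglongrightarrow> sqrt 1"
    by (intro tendsto_real_sqrt) simp
  moreover have "eventually (\<lambda>k. sqrt (1 - (\<Sum>i\<in>{..<n} - {j}. (norm (w k i j))\<^sup>2)) = norm (w k j j)) sequentially"
    using assms by (intro eventually_sequentiallyI[of 1]) (simp flip: norm_w_diag_sq)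
  ultimately show ?thesis by (simp add: Lim_transform_eventually)
qed

lemma norm_tendsto_of_diff:
  fixes f g :: "nat \<Rightarrow> 'a"
  assumes "(\<lambda>k. f k - g k) \<longlonglongrightarrow> 0" and "(\<lambda>k. norm (g k)) \<longlonglongrightarrow> c"
  shows "(\<lambda>k. norm (f k)) \<longlonglongrightarrow> c"
proof -
  have "(\<lambda>k. norm (f k) - norm (g k)) \<longlonglongrightarrow> 0"
    by (rule tendsto_0_le[OF assms(1), where K = 1]) (simp add: norm_triangle_ineq3)
  from tendsto_add[OF this assms(2)] show ?thesis by simp
qed

text \<open>The diagonal case of \<open>w_lower_tendsto\<close>: there \<open>l j j\<close> and the
  ratio are both 1, so T and W have asymptotically equal diagonals. The phase may vary with k, hence
  the norm.\<close>

lemma norm_t_diag_tendsto: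
  assumes "j < m" shows "(\<lambda>k. norm (t k j j)) \<longlonglongrightarrow> 1"
proof (rule norm_tendsto_of_diff)
  show "(\<lambda>k. t k j j - w k j j) \<longlonglongrightarrow> 0"
    using tendsto_minus[OF w_lower_tendsto[of j j]] rho_refl[of j] l_diag[of j] assms m_le_n by simp
qed (rule norm_w_diag_tendsto[OF assms])

lemma norm_s_diag_tendsto:
  assumes "j < m" shows "(\<lambda>k. norm (s k j j)) \<longlonglongrightarrow> 1"
proof (rule norm_tendsto_of_diff)
  show "(\<lambda>k. s k j j - conjugate (w k j j)) \<longlonglongrightarrow> 0"
    using tendsto_minus[OF w_upper_tendsto[of j j]] rho_refl[of j] li_diag[of j] assms m_le_n by simp
qed (use norm_w_diag_tendsto[OF assms] in \<open>simp add: norm_conjugate\<close>)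

lemma norm_w_lower_tendsto:
  assumes "j < m" "i < n"
  shows "(\<lambda>k. norm (w k i j) / (norm (lam i) ^ k / norm (lam j) ^ k)) \<longlonglongrightarrow> norm (l i j)"
proof -
  have "(\<lambda>k. norm (w k i j * \<rho> k j i)) \<longlonglongrightarrow> norm (l i j)"
  proof (rule norm_tendsto_of_diff[OF w_lower_tendsto[OF assms(2,1)]])
    have "(\<lambda>k. norm (l i j) * norm (t k j j)) \<longlonglongrightarrow> norm (l i j) * 1"
      by (intro tendsto_intros norm_t_diag_tendsto assms)
    then show "(\<lambda>k. norm (l i j * t k j j)) \<longlonglongrightarrow> norm (l i j)" by (simp add: norm_mult)
  qed
  then show ?thesis by (simp add: norm_mult norm_divide norm_power power_divide field_simps)
qed

lemma norm_w_upper_tendsto: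
  assumes "j < m" "i < m"
  shows "(\<lambda>k. norm (w k i j) / (norm (lam j) ^ k / norm (lam i) ^ k)) \<longlonglongrightarrow> norm (li j i)"
proof -
  have "(\<lambda>k. norm (conjugate (w k i j) * \<rho> k i j)) \<longlonglongrightarrow> norm (li j i)"
  proof (rule norm_tendsto_of_diff[OF w_upper_tendsto[OF assms(2,1)]])
    have "(\<lambda>k. norm (s k j j) * norm (li j i)) \<longlonglongrightarrow> 1 * norm (li j i)"
      by (intro tendsto_intros norm_s_diag_tendsto assms)
    then show "(\<lambda>k. norm (s k j j * li j i)) \<longlonglongrightarrow> norm (li j i)" by (simp add: norm_mult)
  qed
  then show ?thesis
    by (simp add: norm_mult norm_conjugate norm_divide norm_power power_divide field_simps)
qed

section \<open>Orders of magnitude\<close>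

lemma norm_lam_antimono: "i \<le> j \<Longrightarrow> j < n \<Longrightarrow> norm (lam j) \<le> norm (lam i)"
  using lam_less[of i j] by (cases "i = j") auto

lemma norm_w_ratio_tendsto:
  assumes "j < m" "i < n" "i \<noteq> j"
  shows "(\<lambda>k. norm (w k i j) / (norm (lam (max i j)) ^ k / norm (lam (min i j)) ^ k))
    \<longlonglongrightarrow> (if j < i then norm (l i j) else norm (li j i))"
  using norm_w_lower_tendsto[of j i] norm_w_upper_tendsto[of j i] assms
  by (cases "j < i") (auto simp: max_def min_def)

lemma norm_w_bigtheta:
  assumes "j < m" "i < n" "i \<noteq> j" and "j < i \<Longrightarrow> l i j \<noteq> 0" and "i < j \<Longrightarrow> li j i \<noteq> 0"
  shows "(\<lambda>k. norm (w k i j)) \<in> \<Theta>(\<lambda>k. norm (lam (max i j)) ^ k / norm (lam (min i j)) ^ k)"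
  by (rule bigthetaI_tendsto[OF _ norm_w_ratio_tendsto]) (use assms in auto)

lemma norm_w_sq_bigtheta:
  assumes "j < m" "i < n" "i \<noteq> j" and "j < i \<Longrightarrow> l i j \<noteq> 0" and "i < j \<Longrightarrow> li j i \<noteq> 0"
  shows "(\<lambda>k. (norm (w k i j))\<^sup>2) \<in> \<Theta>(\<lambda>k. (norm (lam (max i j)) / norm (lam (min i j))) ^ (2 * k))"
proof (rule bigthetaI_tendsto)
  show "(if j < i then norm (l i j) else norm (li j i))\<^sup>2 \<noteq> 0" using assms by auto
  have "(x / (a ^ k / b ^ k))\<^sup>2 = x\<^sup>2 / (a / b) ^ (2 * k)" for x a b :: real and k
    by (simp add: power_divide power_mult_distrib power_even_eq)
  then show "(\<lambda>k. (norm (w k i j))\<^sup>2 / (norm (lam (max i j)) / norm (lam (min i j))) ^ (2 * k))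
      \<longlonglongrightarrow> (if j < i then norm (l i j) else norm (li j i))\<^sup>2"
    using tendsto_power[OF norm_w_ratio_tendsto[OF assms(1-3)], of 2]
    by simp
qed

lemma one_minus_norm_w_diag_bigtheta:
  assumes j: "j < m"
    and l: "\<And>i. j < i \<Longrightarrow> i < n \<Longrightarrow> l i j \<noteq> 0" and li: "\<And>i. i < j \<Longrightarrow> li j i \<noteq> 0"
  shows "(\<lambda>k. 1 - norm (w k j j)) \<in> \<Theta>(\<lambda>k.
    (max (if j = 0 then 0 else norm (lam j) / norm (lam (j - 1)))
         (if j + 1 = n then 0 else norm (lam (j + 1)) / norm (lam j))) ^ (2 * k))"
proof -
  define r where "r = max (if j = 0 then 0 else norm (lam j) / norm (lam (j - 1)))
    (if j + 1 = n then 0 else norm (lam (j + 1)) / norm (lam j))"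
  define q where "q i = norm (lam (max i j)) / norm (lam (min i j))" for i
  define g where "g k = (\<Sum>i\<in>{..<n} - {j}. (norm (w k i j))\<^sup>2)" for k
  have jn: "j < n" using j m_le_n by simp
  have "(\<lambda>k. 1 - norm (w k j j)) \<in> \<Theta>(g)"
  \<comment> \<open>The constants come from 1 - x^2 = (1 - x)(1 + x), whose second factor lies
    between 1 and 2 for 0 \<le> x \<le> 1.\<close>
  proof (rule bigthetaI'[of "1/2" 1], simp, simp, rule eventually_sequentiallyI[of 1])
    fix k :: nat assume k: "1 \<le> k"
    have g: "g k = (1 - norm (w k j j)) * (1 + norm (w k j j))"
      using norm_w_diag_sq[OF k j] by (simp add: g_def power2_eq_square algebra_simps)
    have "0 \<le> g k" unfolding g_def by (intro sum_nonneg) simp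
    then have le: "norm (w k j j) \<le> 1"
      using norm_w_diag_sq[OF k j] abs_square_le_1[of "norm (w k j j)"] by (simp add: g_def)
    then have "(1 - norm (w k j j)) * (1 + norm (w k j j)) \<le> (1 - norm (w k j j)) * 2"
      and "(1 - norm (w k j j)) * 1 \<le> (1 - norm (w k j j)) * (1 + norm (w k j j))"
      by (intro mult_left_mono; simp)+
    then show "1 / 2 * norm (g k) \<le> norm (1 - norm (w k j j)) \<and>
        norm (1 - norm (w k j j)) \<le> 1 * norm (g k)"
      using le \<open>0 \<le> g k\<close> g by auto
  qed
  also have "g \<in> \<Theta>(\<lambda>k. r ^ (2 * k))"
  proof (cases "n = 1")
    case True
    then have "j = 0" "r = 0" using jn by (auto simp: r_def)
    have "{..<n} - {j} = {}" using True \<open>j = 0\<close> by auto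
    then have "g k = 0" for k by (simp only: g_def sum.empty)
    \<comment> \<open>Both sides vanish only from k = 1 on, since \<open>0 ^ 0 = 1\<close>.\<close>
    then show ?thesis
      by (intro bigthetaI_cong eventually_sequentiallyI[of 1]) (simp add: \<open>r = 0\<close>)
  next
    case False
    have off: "(\<lambda>k. (norm (w k i j))\<^sup>2) \<in> \<Theta>(\<lambda>k. q i ^ (2 * k))" if "i < n" "i \<noteq> j" for i
      unfolding q_def using that j l li by (intro norm_w_sq_bigtheta) auto
    \<comment> \<open>Moving i away from j on either side shrinks the ratio, so the nearest index on
      that side dominates.\<close>
    have q_le: "q i \<le> r" if i: "i < n" "i \<noteq> j" for i
    proof (cases "j < i")
      case True
      then have "q i \<le> norm (lam (j + 1)) / norm (lam j)"
        using i norm_lam_antimono[of "j + 1" i] by (auto simp: q_def intro!: divide_right_mono)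
      with True i show ?thesis by (auto simp: r_def)
    next
      case False
      with i have "i \<le> j - 1" "0 < j" by auto
      then have "q i \<le> norm (lam j) / norm (lam (j - 1))"
        using jn norm_lam_antimono[of i "j - 1"] lam_nonzero[of i] lam_nonzero[of "j - 1"]
        by (auto simp: q_def intro!: divide_left_mono)
      with \<open>0 < j\<close> show ?thesis by (auto simp: r_def)
    qed
    have q_nonneg: "0 \<le> q i" for i by (simp add: q_def)
    obtain i0 where i0: "i0 < n" "i0 \<noteq> j" "q i0 = r"
    proof -
      have "q (j - 1) = norm (lam j) / norm (lam (j - 1))" if "j \<noteq> 0"
        using that by (simp add: q_def)
      moreover have "q (j + 1) = norm (lam (j + 1)) / norm (lam j)" by (simp add: q_def)
      \<comment> \<open>When j is the last index, the maximum compares this ratio with the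
        conventional 0; strict positivity ensures that an actual neighbour attains it. At least one
        neighbour exists because n is not 1.\<close>
      moreover have "\<not> norm (lam j) / norm (lam (j - 1)) \<le> 0"
        using jn lam_nonzero[of j] lam_nonzero[of "j - 1"] by (simp add: divide_le_0_iff)
      ultimately have "(j \<noteq> 0 \<and> q (j - 1) = r) \<or> (j + 1 < n \<and> q (j + 1) = r)"
        using False jn unfolding r_def max_def by (auto split: if_splits)
      then show thesis
      proof
        assume "j \<noteq> 0 \<and> q (j - 1) = r" then show thesis using jn by (intro that[of "j - 1"]) auto
      next
        assume "j + 1 < n \<and> q (j + 1) = r" then show thesis by (intro that[of "j + 1"]) auto
      qed
    qed
    show ?thesis
    proof (rule bigthetaI)
      show "g \<in> O(\<lambda>k. r ^ (2 * k))"
        unfolding g_def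
      proof (rule big_sum_in_bigo)
        fix i assume "i \<in> {..<n} - {j}"
        then have i: "i < n" "i \<noteq> j" by auto
        have "(\<lambda>k. q i ^ (2 * k)) \<in> O(\<lambda>k. r ^ (2 * k))"
          using power_mono[OF q_le[OF i] q_nonneg] q_nonneg[of i]
          by (intro bigoI[of _ 1] always_eventually allI) (auto simp: abs_mult)
        with off[OF i] show "(\<lambda>k. (norm (w k i j))\<^sup>2) \<in> O(\<lambda>k. r ^ (2 * k))"
          using landau_o.big.bigtheta_trans2 by blast
      qed
      \<comment> \<open>The summands of g are nonnegative, so the single dominant one already bounds
        g from below.\<close>
      have "(\<lambda>k. (norm (w k i0 j))\<^sup>2) \<in> O(g)"
      proof (rule bigoI[of _ 1], rule always_eventually, rule allI)
        fix k
        have "(norm (w k i0 j))\<^sup>2 \<le> g k"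
          unfolding g_def using i0 by (intro member_le_sum) auto
        then show "norm ((norm (w k i0 j))\<^sup>2) \<le> 1 * norm (g k)" by simp
      qed
      moreover have "(\<lambda>k. r ^ (2 * k)) \<in> \<Theta>(\<lambda>k. (norm (w k i0 j))\<^sup>2)"
        using off[OF i0(1,2)] i0(3) by (simp add: bigtheta_sym)
      ultimately have "(\<lambda>k. r ^ (2 * k)) \<in> O(g)"
        using landau_o.big.bigtheta_trans2 by blast
      then show "g \<in> \<Omega>(\<lambda>k. r ^ (2 * k))" by (simp add: bigomega_iff_bigo)
    qed
  qed
  finally show ?thesis unfolding r_def .
qed

end

section \<open>The theorem: passage from matrices to entries\<close>

theorem theorem2p2:
  fixes n m :: nat
    and lam :: "nat \<Rightarrow> 'a :: real_or_complex_field"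
    and V A Y X :: "'a mat"
  assumes "1 \<le> m" and "m \<le> n"
    and "\<forall>i < n. \<forall>j < n. i < j \<longrightarrow> norm (lam j) < norm (lam i)"
    and "\<forall>i < n. 0 < norm (lam i)"
    and "V \<in> carrier_mat n n"
    and "V * mat_adjoint V = 1\<^sub>m n" and "mat_adjoint V * V = 1\<^sub>m n"
    and "A = V * mat_diag n lam * mat_adjoint V"
    and "Y \<in> carrier_mat n m"
    and "X = mat_adjoint V * Y"
    and "\<forall>j \<in> {1..m}. det (submatrix X {..<j} {..<j}) \<noteq> 0"
  shows "(\<exists>!LU. lu_factorization n m X (fst LU) (snd LU)) \<and>
    (\<forall>L U Linv Q R.
      lu_factorization n m X L U \<longrightarrow>
      Linv = the (mat_inverse (submatrix L {..<m} UNIV)) \<longrightarrow>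
      strictly_lower_nonzero L \<longrightarrow>
      strictly_lower_nonzero Linv \<longrightarrow>
      (\<forall>k :: nat. 1 \<le> k \<longrightarrow> qr_factorization n m (A ^\<^sub>m k * Y) (Q k) (R k)) \<longrightarrow>
      (\<exists>\<epsilon> :: nat \<Rightarrow> nat \<Rightarrow> nat \<Rightarrow> real.
        (\<forall>j < m. \<forall>i < n. \<epsilon> i j \<longlonglongrightarrow> 0) \<and>
        (\<forall>j < m. \<forall>i < n. \<forall>k \<ge> 1.
          norm (col (Q k) j \<bullet>c col V i) =
            (if i < j then norm (Linv $$ (j, i)) * (norm (lam j) ^ k / norm (lam i) ^ k) * (1 + \<epsilon> i j k)
             else if i = j then 1 + \<epsilon> i j k
             else norm (L $$ (i, j)) * (norm (lam i) ^ k / norm (lam j) ^ k) * (1 + \<epsilon> i j k)))) \<and>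
      (\<forall>i < n. \<forall>j < m. i \<noteq> j \<longrightarrow>
        (\<lambda>k. norm (col (Q k) j \<bullet>c col V i))
          \<in> \<Theta>(\<lambda>k. norm (lam (max i j)) ^ k / norm (lam (min i j)) ^ k)) \<and>
      (\<forall>j < m.
        (\<lambda>k. 1 - norm (col (Q k) j \<bullet>c col V j))
          \<in> \<Theta>(\<lambda>k. (max (if j = 0 then 0 else norm (lam j) / norm (lam (j - 1)))
                         (if j + 1 = n then 0 else norm (lam (j + 1)) / norm (lam j))) ^ (2 * k))))"
proof (intro conjI allI impI)
  note mn = \<open>m \<le> n\<close> and V = \<open>V \<in> carrier_mat n n\<close> and Y = \<open>Y \<in> carrier_mat n m\<close>
  note V' = mat_adjoint_carrier[OF V]
  have X: "X \<in> carrier_mat n m" using assms(10) V' Y by simp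
  \<comment> \<open>This is the minor for j = m, which lies in \<open>{1..m}\<close> because 1 \<le>
    m.\<close>
  have det_X: "det (mat m m (\<lambda>ij. X $$ ij)) \<noteq> 0"
    using bspec[OF assms(11), of m] assms(1) submatrix_lessThan(1)[OF X mn order_refl] by simp
  show "\<exists>!LU. lu_factorization n m X (fst LU) (snd LU)"
  proof -
    obtain L U where LU: "lu_factorization n m X L U"
      using lu_factorization_exists[OF X mn] assms(11) by blast
    show ?thesis
    proof (rule ex1I[of _ "(L, U)"])
      show "lu_factorization n m X (fst (L, U)) (snd (L, U))" using LU by simp
      fix P assume "lu_factorization n m X (fst P) (snd P)"
      from lu_factorization_unique[OF this LU mn det_X] show "P = (L, U)"
        by (simp add: prod_eq_iff)
    qed
  qed
  fix L U Linv Q R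
  assume LU: "lu_factorization n m X L U"
    and Linv: "Linv = the (mat_inverse (submatrix L {..<m} UNIV))"
    and L_nz: "strictly_lower_nonzero L" and Linv_nz: "strictly_lower_nonzero Linv"
    and QR: "\<forall>k :: nat. 1 \<le> k \<longrightarrow> qr_factorization n m (A ^\<^sub>m k * Y) (Q k) (R k)"
  have L: "L \<in> carrier_mat n m" "unit_lower_triangular L"
    and U: "U \<in> carrier_mat m m" "upper_triangular U" and XLU: "X = L * U"
    using LU by (auto simp: lu_factorization_def)
  note Linv_props = mat_inverse_unit_lower[OF L Linv]
  have lam_nonzero: "lam i \<noteq> 0" if "i < n" for i
    using assms(4) that by force
  have Q: "Q k \<in> carrier_mat n m" "mat_adjoint (Q k) * Q k = 1\<^sub>m m"
    and R: "R k \<in> carrier_mat m m" "upper_triangular (R k)"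
    and QR_eq: "A ^\<^sub>m k * Y = Q k * R k" if "1 \<le> k" for k
    using QR that unfolding qr_factorization_def orthonormal_cols_iff by auto
  define W where "W k = mat_adjoint V * Q k" for k
  define M where "M k = mat n m (\<lambda>(i, j). L $$ (i, j) * (lam i / lam j) ^ k)" for k
  have M: "M k \<in> carrier_mat n m" for k by (simp add: M_def)
  have W: "W k \<in> carrier_mat n m" if "1 \<le> k" for k
    using V' Q(1)[OF that] by (simp add: W_def)
  have WW: "mat_adjoint (W k) * W k = 1\<^sub>m m" if k: "1 \<le> k" for k
  proof -
    note Qk = Q(1)[OF k]
    note Q' = mat_adjoint_carrier[OF Qk]
    have "mat_adjoint (W k) * W k = mat_adjoint (Q k) * V * (mat_adjoint V * Q k)"
      by (simp add: W_def mat_adjoint_mult[OF V' Qk] mat_adjoint_adjoint)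
    also have "\<dots> = mat_adjoint (Q k) * (V * (mat_adjoint V * Q k))"
      using V' Qk by (intro assoc_mult_mat[OF Q' V]) auto
    also have "V * (mat_adjoint V * Q k) = Q k"
      using assoc_mult_mat[OF V V' Qk] assms(6) Qk by simp
    finally show ?thesis using Q(2)[OF k] by simp
  qed
  define S where "S k = mat_adjoint (W k) * M k" for k
  have S_T: "upper_triangular (S k)"
    "\<exists>T. T \<in> carrier_mat m m \<and> upper_triangular T \<and> W k = M k * T" if k: "1 \<le> k" for k
  proof -
    note Qk = Q(1)[OF k] and Rk = R[OF k]
    let ?E = "mat_diag n (\<lambda>i. lam i ^ k)" and ?F = "mat_diag m (\<lambda>j. lam j ^ k)"
    have E: "?E \<in> carrier_mat n n" and F: "?F \<in> carrier_mat m m" by simp_all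
    have F_upper: "upper_triangular ?F" by (auto simp: mat_diag_def)
    have det_F: "det ?F \<noteq> 0"
      using upper_triangular_imp_det_eq_0_iff[OF F F_upper] lam_nonzero mn
      by (auto simp: diag_mat_def mat_diag_def)
    \<comment> \<open>The column scaling is moved to the other factor: \<open>?E * L * U\<close>
      becomes \<open>M k * (?F * U)\<close>, where \<open>?F * U\<close> is still upper triangular
      and nonsingular while \<open>M k\<close> has unit diagonal.\<close>
    have MF: "M k * ?F = ?E * L"
      unfolding mat_diag_mult_right[OF M] mat_diag_mult_left[OF L(1)]
      using mn lam_nonzero by (intro cong_mat) (auto simp: M_def power_divide)
    have Ak: "A ^\<^sub>m k \<in> carrier_mat n n" using assms(8) V V' by auto
    have "W k * R k = mat_adjoint V * (A ^\<^sub>m k * Y)"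
      unfolding W_def QR_eq[OF k] by (rule assoc_mult_mat[OF V' Qk Rk(1)])
    also have "\<dots> = mat_adjoint V * A ^\<^sub>m k * Y"
      using assoc_mult_mat[OF V' Ak Y] by simp
    also have "mat_adjoint V * A ^\<^sub>m k = ?E * mat_adjoint V"
      unfolding assms(8) by (rule unitary_conjugate_diag_pow[OF V assms(7,6)])
    also have "?E * mat_adjoint V * Y = ?E * X"
      unfolding assms(10) by (rule assoc_mult_mat[OF E V' Y])
    also have "\<dots> = ?E * L * U"
      unfolding XLU using assoc_mult_mat[OF E L(1) U(1)] by simp
    also have "\<dots> = M k * (?F * U)"
      unfolding MF[symmetric] by (rule assoc_mult_mat[OF M F U(1)])
    finally have WR: "W k * R k = M k * (?F * U)" .
    have M_unit: "unit_lower_triangular (M k)"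
      using L mn lam_nonzero by (auto simp: unit_lower_triangular_def M_def)
    have FU: "?F * U \<in> carrier_mat m m" by (rule mult_carrier_mat[OF F U(1)])
    have "det (?F * U) \<noteq> 0"
      using det_F lu_factorization_det[OF LU mn det_X] det_mult[OF F U(1)] by simp
    from orthonormal_triangular_factors[OF W[OF k] WW[OF k] Rk M M_unit FU
        upper_triangular_mult[OF F U(1) F_upper U(2)] this WR]
    show "upper_triangular (S k)" "\<exists>T. T \<in> carrier_mat m m \<and> upper_triangular T \<and> W k = M k * T"
      unfolding S_def .
  qed
  then obtain T where T: "\<And>k. 1 \<le> k \<Longrightarrow> T k \<in> carrier_mat m m"
    "\<And>k. 1 \<le> k \<Longrightarrow> upper_triangular (T k)" "\<And>k. 1 \<le> k \<Longrightarrow> W k = M k * T k"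
    by metis
  interpret qr_of_scaled_lu n m lam "\<lambda>i j. L $$ (i, j)" "\<lambda>i j. Linv $$ (i, j)"
    "\<lambda>k i j. W k $$ (i, j)" "\<lambda>k i j. S k $$ (i, j)" "\<lambda>k i j. T k $$ (i, j)"
  proof
    show "m \<le> n" by (rule mn)
    show "norm (lam j) < norm (lam i)" if "i < j" "j < n" for i j
      using assms(3) that by auto
    show "lam i \<noteq> 0" if "i < n" for i by (rule lam_nonzero[OF that])
    show "L $$ (j, j) = 1" if "j < m" for j
      using L that by (simp add: unit_lower_triangular_def)
    show "L $$ (i, j) = 0" if "i < j" "j < m" for i j
      using L that by (simp add: unit_lower_triangular_def)
    show "Linv $$ (i, j) = 0" if "i < j" "j < m" for i j
      by (rule Linv_props(4)[OF that])
    have top: "mat m m (\<lambda>ij. L $$ ij) \<in> carrier_mat m m" by simp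
    show "(\<Sum>p<m. L $$ (i, p) * Linv $$ (p, j)) = (if i = j then 1 else 0)" if "i < m" "j < m" for i j
      using index_mult_mat_sum[OF top Linv_props(1) that] that by (simp add: Linv_props(2))
    show "(\<Sum>p<m. Linv $$ (i, p) * L $$ (p, j)) = (if i = j then 1 else 0)" if "i < m" "j < m" for i j
      using index_mult_mat_sum[OF Linv_props(1) top that] that by (simp add: Linv_props(3))
    show "(\<Sum>i<n. (norm (W k $$ (i, j)))\<^sup>2) = 1" if k: "1 \<le> k" and j: "j < m" for k j
    proof -
      note Wk = W[OF k]
      \<comment> \<open>The real column sum is embedded in the field, where
        \<open>mult_conjugate\<close> identifies it with a diagonal entry of W^* W; injectivity of
        \<open>of_real\<close> brings the value 1 back.\<close>
      have "of_real (\<Sum>i<n. (norm (W k $$ (i, j)))\<^sup>2) = (mat_adjoint (W k) * W k) $$ (j, j)"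
        using Wk j unfolding index_mult_mat_sum[OF mat_adjoint_carrier[OF Wk] Wk j j]
        by (simp add: index_mat_adjoint mult_conjugate mult.commute[of "conjugate _"])
      also have "\<dots> = 1" using WW[OF k] j by simp
      finally show ?thesis by (simp only: of_real_eq_1_iff)
    qed
    show "W k $$ (i, j) = (\<Sum>p<m. L $$ (i, p) * (lam i / lam p) ^ k * T k $$ (p, j))"
      if "1 \<le> k" "i < n" "j < m" for k i j
      using index_mult_mat_sum[OF M T(1)[OF that(1)] that(2,3), of k] that
      by (simp add: T(3)[OF that(1), symmetric]) (simp add: M_def)
    show "T k $$ (i, j) = 0" if "1 \<le> k" "j < i" "i < m" for k i j
      using T(1)[OF that(1)] that by (intro upper_triangularD[OF T(2)]) auto
    show "S k $$ (j, i) = (\<Sum>p<n. conjugate (W k $$ (p, j)) * (L $$ (p, i) * (lam p / lam i) ^ k))"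
      if "1 \<le> k" "i < m" "j < m" for k i j
      using index_mult_mat_sum[OF mat_adjoint_carrier[OF W[OF that(1)]] M that(3,2)] W[OF that(1)] that
      unfolding S_def by (simp only:) (simp add: M_def index_mat_adjoint)
    show "S k $$ (i, j) = 0" if "1 \<le> k" "j < i" "i < m" for k i j
      using mat_adjoint_carrier[OF W[OF that(1)]] that
      by (intro upper_triangularD[OF S_T(1)]) (auto simp: S_def)
  qed
  have entry: "col (Q k) j \<bullet>c col V i = W k $$ (i, j)" if "1 \<le> k" "i < n" "j < m" for k i j
    using Q(1)[OF that(1)] V that unfolding W_def index_mult_mat_sum[OF V' Q(1)[OF that(1)] that(2,3)]
    by (simp add: index_mat_adjoint scalar_prod_def atLeast0LessThan mult.commute)
  have L_lower: "L $$ (i, j) \<noteq> 0" if "j < m" "j < i" "i < n" for i j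
    using L_nz L that by (auto simp: strictly_lower_nonzero_def)
  have Linv_lower: "Linv $$ (j, i) \<noteq> 0" if "j < m" "i < j" for i j
    using Linv_nz Linv_props(1) that by (auto simp: strictly_lower_nonzero_def)
  \<comment> \<open>The identity \<open>entry\<close> is available only for k \<ge> 1, since
    \<open>Q 0\<close> is arbitrary; the asymptotic class ignores this one index. The function f is
    the identity for off-diagonal entries and \<open>1 - x\<close> on the diagonal.\<close>
  have bigtheta: "(\<lambda>k. f (norm (col (Q k) j \<bullet>c col V i))) \<in> \<Theta>(g)"
    if "(\<lambda>k. f (norm (W k $$ (i, j)))) \<in> \<Theta>(g)" "i < n" "j < m" for f g :: "_ \<Rightarrow> real" and i j
    by (rule landau_theta.in_cong[THEN iffD1, OF _ that(1)])
      (use entry that(2,3) in \<open>auto intro: eventually_sequentiallyI[of 1]\<close>)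
  show "(\<lambda>k. norm (col (Q k) j \<bullet>c col V i)) \<in> \<Theta>(\<lambda>k. norm (lam (max i j)) ^ k / norm (lam (min i j)) ^ k)"
    if "i < n" "j < m" "i \<noteq> j" for i j
    using bigtheta[of "\<lambda>x. x"] norm_w_bigtheta[of j i] L_lower[of j i] Linv_lower[of j i] that by blast
  show "(\<lambda>k. 1 - norm (col (Q k) j \<bullet>c col V j)) \<in> \<Theta>(\<lambda>k.
      (max (if j = 0 then 0 else norm (lam j) / norm (lam (j - 1)))
           (if j + 1 = n then 0 else norm (lam (j + 1)) / norm (lam j))) ^ (2 * k))" if "j < m" for j
    using bigtheta[of "\<lambda>x. 1 - x" j j] one_minus_norm_w_diag_bigtheta[of j] L_lower[of j] Linv_lower[of j]
      that mn by force
  \<comment> \<open>The predicted leading term. It may be divided by because the strictly lower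
    entries of L and of the inverse are nonzero.\<close>
  define c where "c i j k =
    (if i < j then norm (Linv $$ (j, i)) * (norm (lam j) ^ k / norm (lam i) ^ k) else if i = j then 1
     else norm (L $$ (i, j)) * (norm (lam i) ^ k / norm (lam j) ^ k))" for i j k
  have c_mult: "c i j k * (1 + x) =
      (if i < j then norm (Linv $$ (j, i)) * (norm (lam j) ^ k / norm (lam i) ^ k) * (1 + x)
       else if i = j then 1 + x
       else norm (L $$ (i, j)) * (norm (lam i) ^ k / norm (lam j) ^ k) * (1 + x))" for i j k x
    by (simp add: c_def)
  have c_nonzero: "c i j k \<noteq> 0" if "i < n" "j < m" for i j k
    using that mn lam_nonzero[of i] lam_nonzero[of j] L_lower[of j i] Linv_lower[of j i]
    by (auto simp: c_def)
  have lim: "(\<lambda>k. norm (W k $$ (i, j)) / c i j k) \<longlonglongrightarrow> 1" if "i < n" "j < m" for i j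
  proof (cases i j rule: linorder_cases)
    case less
    then have "(\<lambda>k. norm (W k $$ (i, j)) / (norm (lam j) ^ k / norm (lam i) ^ k) / norm (Linv $$ (j, i)))
        \<longlonglongrightarrow> norm (Linv $$ (j, i)) / norm (Linv $$ (j, i))"
      using that Linv_lower[of j i] by (intro tendsto_divide norm_w_upper_tendsto tendsto_const) auto
    with less that Linv_lower[of j i] show ?thesis by (simp add: c_def mult.commute)
  next
    case equal
    with norm_w_diag_tendsto[OF that(2)] show ?thesis by (simp add: c_def)
  next
    case greater
    then have "(\<lambda>k. norm (W k $$ (i, j)) / (norm (lam i) ^ k / norm (lam j) ^ k) / norm (L $$ (i, j)))
        \<longlonglongrightarrow> norm (L $$ (i, j)) / norm (L $$ (i, j))"
      using that L_lower[of j i] by (intro tendsto_divide norm_w_lower_tendsto tendsto_const) auto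
    with greater that L_lower[of j i] show ?thesis by (simp add: c_def mult.commute)
  qed
  show "\<exists>\<epsilon> :: nat \<Rightarrow> nat \<Rightarrow> nat \<Rightarrow> real.
        (\<forall>j < m. \<forall>i < n. \<epsilon> i j \<longlonglongrightarrow> 0) \<and>
        (\<forall>j < m. \<forall>i < n. \<forall>k \<ge> 1.
          norm (col (Q k) j \<bullet>c col V i) =
            (if i < j then norm (Linv $$ (j, i)) * (norm (lam j) ^ k / norm (lam i) ^ k) * (1 + \<epsilon> i j k)
             else if i = j then 1 + \<epsilon> i j k
             else norm (L $$ (i, j)) * (norm (lam i) ^ k / norm (lam j) ^ k) * (1 + \<epsilon> i j k)))"
  proof (intro exI conjI allI impI)
    \<comment> \<open>The relative error is defined by solving the claimed equation for it, so the
      equation is exact for every k \<ge> 1 and only the limit carries asymptotic content.\<close>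
    let ?\<epsilon> = "\<lambda>i j k. norm (W k $$ (i, j)) / c i j k - 1"
    show "?\<epsilon> i j \<longlonglongrightarrow> 0" if "j < m" "i < n" for i j
      using tendsto_diff[OF lim[OF that(2,1)] tendsto_const[of 1]] by simp
    fix i j k assume ij: "j < m" "i < n" and k: "(1 :: nat) \<le> k"
    have "norm (col (Q k) j \<bullet>c col V i) = c i j k * (1 + ?\<epsilon> i j k)"
      using c_nonzero[OF ij(2,1)] by (simp add: entry[OF k ij(2,1)])
    also have "\<dots> = (if i < j then norm (Linv $$ (j, i)) * (norm (lam j) ^ k / norm (lam i) ^ k) * (1 + ?\<epsilon> i j k)
             else if i = j then 1 + ?\<epsilon> i j k
             else norm (L $$ (i, j)) * (norm (lam i) ^ k / norm (lam j) ^ k) * (1 + ?\<epsilon> i j k))"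
      by (rule c_mult)
    finally show "norm (col (Q k) j \<bullet>c col V i) =
            (if i < j then norm (Linv $$ (j, i)) * (norm (lam j) ^ k / norm (lam i) ^ k) * (1 + ?\<epsilon> i j k)
             else if i = j then 1 + ?\<epsilon> i j k
             else norm (L $$ (i, j)) * (norm (lam i) ^ k / norm (lam j) ^ k) * (1 + ?\<epsilon> i j k))" .
  qed
qed

end
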